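(* Let $(\mathbf W_j^{(1),n},\mathbf W_j^{(2),n})_{j\in\mathbb Z}$ be given cell-averaged values at time $t^n$, and suppose the CFL condition $\Delta t\le \Delta x/\max_{1\le i\le n}|\lambda_i|$ holds. Then the staggered scheme (defined in the context) is asymptotic preserving, in the following sense. (i) For every $\varepsilon>0$ the scheme is consistent (in the usual finite-volume sense) with solutions of the relaxation system $\partial_t\mathbf W+\partial_x\mathbf f(\mathbf W)=\frac1\varepsilon\mathbf R(\mathbf W)$. (ii) In the limit $\varepsilon\to0$ (with $\Delta t$, $\Delta x$ and the data at time $t^n$ fixed) it converges to the stable and consistent FORCE scheme for the equilibrium system $\partial_t\mathbf W^{(1)}+\partial_x\mathbf f^{(1)}(\mathbf W^{(1)},\mathbf Q(\mathbf W^{(1)}))=0$, that is, to $$\mathbf W_j^{(1),n+1}=\mathbf W_j^{(1),n}-\frac{\Delta t}{\Delta x}\left(\tilde{\mathbf F}^{(1)}_{0,j+1/2}-\tilde{\mathbf F}^{(1)}_{0,j-1/2}\right),$$ where, writing $\mathbf f_{eq}(\mathbf V):=\mathbf f^{(1)}(\mathbf V,\mathbf Q(\mathbf V))$, $$\tilde{\mathbf F}^{(1)}_{0,j+1/2}=\frac14\left[2\mathbf f_{eq}\big(\mathbf W^{(1),n+1/2}_{j+1/2}\big)+\mathbf f_{eq}\big(\mathbf W^{(1),n}_{j+1}\big)+\mathbf f_{eq}\big(\mathbf W^{(1),n}_{j}\big)-\frac{\Delta x}{\Delta t}\big(\mathbf W^{(1),n}_{j+1}-\mathbf W^{(1),n}_{j}\big)\right],$$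 $$\mathbf W^{(1),n+1/2}_{j+1/2}=\frac12\big(\mathbf W^{(1),n}_{j}+\mathbf W^{(1),n}_{j+1}\big)-\frac{\Delta t}{2\Delta x}\left(\mathbf f_{eq}\big(\mathbf W^{(1),n}_{j+1}\big)-\mathbf f_{eq}\big(\mathbf W^{(1),n}_{j}\big)\right).$$
   Context: Setting. $K\subset\mathbb R^n$ is a convex set of admissible states. The relaxation system is $\partial_t \mathbf W+\partial_x\mathbf f(\mathbf W)=\frac1\varepsilon\mathbf R(\mathbf W)$ with $\mathbf W(t,x)\in K$, where $\mathbf f$ is smooth and for each $\mathbf W\in K$ the Jacobian $\nabla\mathbf f(\mathbf W)$ is diagonalizable over $\mathbb R$ with eigenvalues $\lambda_1\le\dots\le\lambda_n$ (in the CFL condition the maximum is also over the states involved). There are linear maps $M_1:\mathbb R^n\to\mathbb R^k$ of rank $k$ and $M_2:\mathbb R^n\to\mathbb R^{n-k}$ of rank $n-k$ with $\begin{pmatrix}M_1\\ M_2\end{pmatrix}$ nonsingular and $M_1\mathbf R(\mathbf W)=0$ on $K$. Write $\mathbf W^{(i)}=M_i\mathbf W$, $\mathbf f^{(i)}=M_i\mathbf f$, $\mathbf R^{(i)}=M_i\mathbf R$ and $\mathbf f^{(i)}(\mathbf W^{(1)},\mathbf W^{(2)})=\mathbf f^{(i)}(\mathbf W)$. The source term is $\mathbf R^{(2)}(\mathbf W)=\mathbf Q(\mathbf W^{(1)})-\mathbf W^{(2)}$ with $\mathbf Q:\mathbb R^k\to\mathbb R^{n-k}$ a (possibly nonlinear)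 smooth map, and one assumes $\nabla\mathbf f^{(2)}(\mathbf W)\,\mathbf R(\mathbf W)=0$ for $\mathbf W\in K$. For every $\mathbf W^{(1)}\in M_1K$ the equilibrium state with components $(\mathbf W^{(1)},\mathbf Q(\mathbf W^{(1)}))$ lies in $K$. All states generated by the scheme are understood to lie in $K$. Staggered scheme. Uniform mesh of cells $(x_{j-1/2},x_{j+1/2})$ of size $\Delta x$, time step $\Delta t$. Given $(\mathbf W_j^n)_{j\in\mathbb Z}$: Step 1. Let $\mathbf W^L_{j-1/2}(t)$, $\mathbf W^R_{j-1/2}(t)$, $t\in(0,\Delta t/2)$, solve $\frac{d}{dt}\mathbf W=\frac1\varepsilon\mathbf R(\mathbf W)$ with initial data $\mathbf W^L_{j-1/2}(0)=\mathbf W^n_{j-1}$ and $\mathbf W^R_{j-1/2}(0)=\mathbf W^n_j$. Define $\mathbf W_{j-1/2}^{n+1/2}$ by $$\mathbf W_{j-1/2}^{n+1/2}=\tfrac12(\mathbf W_j^n+\mathbf W_{j-1}^n)-\tfrac{\Delta t}{2\Delta x}\left[\mathbf f(\mathbf W_{j-1/2}^R(\tfrac{\Delta t}2))-\mathbf f(\mathbf W_{j-1/2}^L(\tfrac{\Delta t}2))\right]+\tfrac{\Delta t}{2\varepsilon}\mathbf R(\mathbf W_{j-1/2}^{n+1/2}).$$ Step 2. Repeat on the shifted grid: let $\mathbf W^L_j$, $\mathbf W^R_j$ solve the same ODE with initial data $\mathbf W^L_j(0)=\mathbf W^{n+1/2}_{j-1/2}$, $\mathbf W^R_j(0)=\mathbf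 W^{n+1/2}_{j+1/2}$, and define $\mathbf W_j^{n+1}$ by $$\mathbf W_{j}^{n+1}=\tfrac12(\mathbf W_{j-1/2}^{n+1/2}+\mathbf W_{j+1/2}^{n+1/2})-\tfrac{\Delta t}{2\Delta x}\left[\mathbf f(\mathbf W_{j}^R(\tfrac{\Delta t}2))-\mathbf f(\mathbf W_{j}^L(\tfrac{\Delta t}2))\right]+\tfrac{\Delta t}{2\varepsilon}\mathbf R(\mathbf W_{j}^{n+1}).$$ Equivalently, $$\mathbf W_j^{n+1}=\mathbf W_j^n-\tfrac{\Delta t}{\Delta x}(\tilde{\mathbf F}_{j+1/2}-\tilde{\mathbf F}_{j-1/2})+\tfrac{\Delta t}{4\varepsilon}\left(2\mathbf R(\mathbf W_j^{n+1})+\mathbf R(\mathbf W_{j-1/2}^{n+1/2})+\mathbf R(\mathbf W_{j+1/2}^{n+1/2})\right),$$ $$\tilde{\mathbf F}_{j+1/2}=\tfrac14\left[2\mathbf f(\mathbf W_j^R(\tfrac{\Delta t}2))+\mathbf f(\mathbf W_{j-1/2}^R(\tfrac{\Delta t}2))+\mathbf f(\mathbf W_{j+1/2}^R(\tfrac{\Delta t}2))-\tfrac{\Delta x}{\Delta t}(\mathbf W_{j+1}^n-\mathbf W_j^n)\right].$$ The FORCE flux for a system of conservation laws is the arithmetic average of the Lax–Friedrichs flux and the two-step Richtmyer (Lax–Wendroff) flux.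
   Formalization: "Stable" is false from the stated CFL alone; it is proved as l² stability of the FORCE scheme linearized at constant states V where ∇f_eq(V) is real diagonalizable with speeds bounded by the |λ_i| in the CFL maximum. Limit half-step states are assumed to lie in M_1K. *)

theory Defs
  imports "HOL-Analysis.Analysis"
begin

(* Meant for open S. In finite dimension, continuity of all iterated directional derivatives
   up to order k is equivalent to being of class C^k. *)
primrec Ck_on :: "nat \<Rightarrow> ('a::euclidean_space \<Rightarrow> 'b::euclidean_space) \<Rightarrow> 'a set \<Rightarrow> bool" where
  "Ck_on 0 g S \<longleftrightarrow> continuous_on S g"
| "Ck_on (Suc k) g S \<longleftrightarrow>
     (\<forall>x\<in>S. g differentiable (at x)) \<and> (\<forall>v. Ck_on k (\<lambda>x. frechet_derivative g (at x) v) S)"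

definition smooth_on :: "('a::euclidean_space \<Rightarrow> 'b::euclidean_space) \<Rightarrow> 'a set \<Rightarrow> bool" where
  "smooth_on g S \<longleftrightarrow> (\<forall>k. Ck_on k g S)"

definition eigenvalue :: "real^'n^'n \<Rightarrow> real \<Rightarrow> bool" where
  "eigenvalue A l \<longleftrightarrow> (\<exists>v. v \<noteq> 0 \<and> A *v v = l *\<^sub>R v)"

definition real_diagonalizable :: "real^'n^'n \<Rightarrow> bool" where
  "real_diagonalizable A \<longleftrightarrow>
     (\<exists>(P::real^'n^'n) (D::real^'n^'n). invertible P \<and> (\<forall>i j. i \<noteq> j \<longrightarrow> D $ i $ j = 0) \<and> A = P ** D ** matrix_inv P)"

text \<open>The state with components \<open>M1 W = u\<close> and \<open>M2 W = v\<close>.\<close>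

definition state_of :: "real^'n^'k \<Rightarrow> real^'n^'m \<Rightarrow> real^'k \<Rightarrow> real^'m \<Rightarrow> real^'n" where
  "state_of M1 M2 u v = inv (\<lambda>W. (M1 *v W, M2 *v W)) (u, v)"

definition equilibrium ::
  "real^'n^'k \<Rightarrow> real^'n^'m \<Rightarrow> (real^'k \<Rightarrow> real^'m) \<Rightarrow> real^'k \<Rightarrow> real^'n" where
  "equilibrium M1 M2 Q u = state_of M1 M2 u (Q u)"

definition equilibrium_flux ::
  "(real^'n \<Rightarrow> real^'n) \<Rightarrow> real^'n^'k \<Rightarrow> real^'n^'m \<Rightarrow> (real^'k \<Rightarrow> real^'m) \<Rightarrow> real^'k \<Rightarrow> real^'k" where
  "equilibrium_flux f M1 M2 Q u = M1 *v f (equilibrium M1 M2 Q u)"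

text \<open>As \<open>K\<close> need not be open, smoothness of \<open>f\<close> on \<open>K\<close> means smoothness on an open
  neighbourhood of \<open>K\<close>. Nothing is assumed about \<open>R\<close> outside \<open>K\<close>.\<close>

locale relaxation_system =
  fixes K :: "(real^'n) set"
    and f R :: "real^'n \<Rightarrow> real^'n"
    and M1 :: "real^'n^'k"
    and M2 :: "real^'n^'m"
    and Q :: "real^'k \<Rightarrow> real^'m"
  assumes convex_K: "convex K"
    and smooth_f: "\<exists>U. open U \<and> K \<subseteq> U \<and> smooth_on f U"
    and hyperbolic: "W \<in> K \<Longrightarrow> real_diagonalizable (jacobian f (at W))"
    and dims: "CARD('k) + CARD('m) = CARD('n)"
    and rank_M1: "rank M1 = CARD('k)"
    and rank_M2: "rank M2 = CARD('m)"
    and nonsingular: "bij (\<lambda>W. (M1 *v W, M2 *v W))"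
    and conserved: "W \<in> K \<Longrightarrow> M1 *v R W = 0"
    and relaxed: "W \<in> K \<Longrightarrow> M2 *v R W = Q (M1 *v W) - M2 *v W"
    and smooth_Q: "smooth_on Q UNIV"
    and flux2_invariant: "W \<in> K \<Longrightarrow> jacobian (\<lambda>V. M2 *v f V) (at W) *v R W = 0"
    and equilibrium_in_K: "u \<in> (\<lambda>W. M1 *v W) ` K \<Longrightarrow> equilibrium M1 M2 Q u \<in> K"

definition relaxation_solution ::
  "(real^'n) set \<Rightarrow> (real^'n \<Rightarrow> real^'n) \<Rightarrow> real \<Rightarrow> real \<Rightarrow> real^'n \<Rightarrow> (real \<Rightarrow> real^'n) \<Rightarrow> bool" where
  "relaxation_solution K R \<epsilon> T W0 w \<longleftrightarrow> w 0 = W0 \<and>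
     (\<forall>t\<in>{0..T}. w t \<in> K \<and>
        (w has_vector_derivative (1 / \<epsilon>) *\<^sub>R R (w t)) (at t within {0..T}))"

text \<open>One step from time \<open>n\<close> to \<open>n + 1\<close>. Half-integer positions are shifted up:
  \<open>half j\<close>, \<open>relax1L j\<close>, \<open>relax1R j\<close> belong to \<open>x_{j+1/2}\<close>, while \<open>cells j\<close>, \<open>relax2L j\<close>,
  \<open>relax2R j\<close>, \<open>new j\<close> belong to \<open>x_j\<close>.\<close>

record ('n::finite) run =
  cells :: "int \<Rightarrow> real^'n"
  relax1L :: "int \<Rightarrow> real \<Rightarrow> real^'n"
  relax1R :: "int \<Rightarrow> real \<Rightarrow> real^'n"
  half :: "int \<Rightarrow> real^'n"
  relax2L :: "int \<Rightarrow> real \<Rightarrow> real^'n"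
  relax2R :: "int \<Rightarrow> real \<Rightarrow> real^'n"
  new :: "int \<Rightarrow> real^'n"

definition half_step ::
  "(real^'n) set \<Rightarrow> (real^'n \<Rightarrow> real^'n) \<Rightarrow> (real^'n \<Rightarrow> real^'n) \<Rightarrow> real \<Rightarrow> real \<Rightarrow> real \<Rightarrow>
   real^'n \<Rightarrow> real^'n \<Rightarrow> (real \<Rightarrow> real^'n) \<Rightarrow> (real \<Rightarrow> real^'n) \<Rightarrow> real^'n \<Rightarrow> bool" where
  "half_step K f R \<epsilon> dt dx Wl Wr wL wR W \<longleftrightarrow>
     relaxation_solution K R \<epsilon> (dt / 2) Wl wL \<and>
     relaxation_solution K R \<epsilon> (dt / 2) Wr wR \<and>
     W \<in> K \<and>
     W = (1 / 2) *\<^sub>R (Wr + Wl) - (dt / (2 * dx)) *\<^sub>R (f (wR (dt / 2)) - f (wL (dt / 2)))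
           + (dt / (2 * \<epsilon>)) *\<^sub>R R W"

definition staggered_step ::
  "(real^'n) set \<Rightarrow> (real^'n \<Rightarrow> real^'n) \<Rightarrow> (real^'n \<Rightarrow> real^'n) \<Rightarrow> real \<Rightarrow> real \<Rightarrow> real \<Rightarrow>
   'n run \<Rightarrow> bool" where
  "staggered_step K f R \<epsilon> dt dx r \<longleftrightarrow>
     (\<forall>j. cells r j \<in> K \<and>
        half_step K f R \<epsilon> dt dx (cells r j) (cells r (j + 1))
          (relax1L r j) (relax1R r j) (half r j) \<and>
        half_step K f R \<epsilon> dt dx (half r (j - 1)) (half r j)
          (relax2L r j) (relax2R r j) (new r j))"

text \<open>The numerical flux at \<open>x_{j+1/2}\<close> and the numerical source in cell \<open>j\<close>.\<close>

definition staggered_flux ::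
  "(real^'n \<Rightarrow> real^'n) \<Rightarrow> real \<Rightarrow> real \<Rightarrow> 'n run \<Rightarrow> int \<Rightarrow> real^'n" where
  "staggered_flux f dt dx r j = (1 / 4) *\<^sub>R
     (2 *\<^sub>R f (relax2R r j (dt / 2)) + f (relax1R r (j - 1) (dt / 2)) + f (relax1R r j (dt / 2))
      - (dx / dt) *\<^sub>R (cells r (j + 1) - cells r j))"

definition staggered_source ::
  "(real^'n \<Rightarrow> real^'n) \<Rightarrow> real \<Rightarrow> 'n run \<Rightarrow> int \<Rightarrow> real^'n" where
  "staggered_source R \<epsilon> r j =
     (1 / (4 * \<epsilon>)) *\<^sub>R (2 *\<^sub>R R (new r j) + R (half r (j - 1)) + R (half r j))"

definition run_states :: "real \<Rightarrow> 'n::finite run \<Rightarrow> (real^'n) set" where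
  "run_states dt r = range (cells r) \<union> range (half r) \<union> range (new r)
     \<union> range (\<lambda>j. relax1L r j (dt / 2)) \<union> range (\<lambda>j. relax1R r j (dt / 2))
     \<union> range (\<lambda>j. relax2L r j (dt / 2)) \<union> range (\<lambda>j. relax2R r j (dt / 2))"

text \<open>\<open>dt \<le> dx / max |\<lambda>|\<close> over the states in \<open>S\<close>, multiplied out so that it also makes sense
  when every eigenvalue vanishes.\<close>

definition CFL :: "(real^'n \<Rightarrow> real^'n) \<Rightarrow> real \<Rightarrow> real \<Rightarrow> (real^'n) set \<Rightarrow> bool" where
  "CFL f dt dx S \<longleftrightarrow> (\<forall>W\<in>S. \<forall>l. eigenvalue (jacobian f (at W)) l \<longrightarrow> dt * \<bar>l\<bar> \<le> dx)"

definition cell_average :: "(real \<Rightarrow> real^'n) \<Rightarrow> real \<Rightarrow> real \<Rightarrow> real^'n" where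
  "cell_average g x dx = (1 / dx) *\<^sub>R integral {x - dx / 2 .. x + dx / 2} g"

definition classical_solution ::
  "(real^'n) set \<Rightarrow> (real^'n \<Rightarrow> real^'n) \<Rightarrow> (real^'n \<Rightarrow> real^'n) \<Rightarrow> real \<Rightarrow> real \<Rightarrow>
   (real \<Rightarrow> real \<Rightarrow> real^'n) \<Rightarrow> bool" where
  "classical_solution K f R \<epsilon> T w \<longleftrightarrow> (\<exists>wt wx.
     continuous_on ({0..T} \<times> UNIV) (\<lambda>(t, x). wt t x) \<and>
     continuous_on ({0..T} \<times> UNIV) (\<lambda>(t, x). wx t x) \<and>
     (\<forall>t\<in>{0..T}. \<forall>x. w t x \<in> K \<and>
        ((\<lambda>s. w s x) has_vector_derivative wt t x) (at t within {0..T}) \<and>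
        ((\<lambda>y. w t y) has_vector_derivative wx t x) (at x) \<and>
        ((\<lambda>y. f (w t y)) has_vector_derivative ((1 / \<epsilon>) *\<^sub>R R (w t x) - wt t x)) (at x)))"

text \<open>Finite-volume consistency along refinements with constant ratio \<open>\<sigma> = dt / dx\<close>: the step
  has conservative form, its flux and source agree to first order with \<open>f\<close> and \<open>R / \<epsilon>\<close> when all
  stencil values are near a common state, and the local truncation error on cell averages of
  classical solutions vanishes. The term \<open>dt\<close> in the flux estimate cannot be dropped: constant data
  that is not in equilibrium relaxes during the step, so the flux differs from \<open>f W\<close>
  by \<open>O(dt)\<close>. Since the mesh may be translated, the truncation error is taken in cell 0,
  centred at \<open>x\<close>.\<close>

definition conservative_form ::
  "(real^'n) set \<Rightarrow> (real^'n \<Rightarrow> real^'n) \<Rightarrow> (real^'n \<Rightarrow> real^'n) \<Rightarrow> real \<Rightarrow> bool" where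
  "conservative_form K f R \<epsilon> \<longleftrightarrow> (\<forall>dt dx r j.
     0 < dt \<and> 0 < dx \<and> staggered_step K f R \<epsilon> dt dx r \<longrightarrow>
     new r j = cells r j
       - (dt / dx) *\<^sub>R (staggered_flux f dt dx r j - staggered_flux f dt dx r (j - 1))
       + dt *\<^sub>R staggered_source R \<epsilon> r j)"

definition flux_consistent ::
  "(real^'n) set \<Rightarrow> (real^'n \<Rightarrow> real^'n) \<Rightarrow> (real^'n \<Rightarrow> real^'n) \<Rightarrow> real \<Rightarrow> bool" where
  "flux_consistent K f R \<epsilon> \<longleftrightarrow> (\<forall>W\<in>K. \<forall>\<sigma>>0. \<exists>L. \<exists>\<delta>>0. \<forall>dt dx r j.
     0 < dx \<and> dt = \<sigma> * dx \<and> dt < \<delta> \<and> staggered_step K f R \<epsilon> dt dx r \<and>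
     norm (cells r j - W) < \<delta> \<and> norm (cells r (j + 1) - W) < \<delta> \<longrightarrow>
     norm (staggered_flux f dt dx r j - f W)
       \<le> L * (norm (cells r j - W) + norm (cells r (j + 1) - W) + dt))"

definition source_consistent ::
  "(real^'n) set \<Rightarrow> (real^'n \<Rightarrow> real^'n) \<Rightarrow> (real^'n \<Rightarrow> real^'n) \<Rightarrow> real \<Rightarrow> bool" where
  "source_consistent K f R \<epsilon> \<longleftrightarrow> (\<forall>W\<in>K. \<forall>\<sigma>>0. \<exists>L. \<exists>\<delta>>0. \<forall>dt dx r j.
     0 < dx \<and> dt = \<sigma> * dx \<and> dt < \<delta> \<and> staggered_step K f R \<epsilon> dt dx r \<and>
     (\<forall>i\<in>{j - 1..j + 1}. norm (cells r i - W) < \<delta>) \<longrightarrow>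
     norm (staggered_source R \<epsilon> r j - (1 / \<epsilon>) *\<^sub>R R W)
       \<le> L * ((\<Sum>i=j - 1..j + 1. norm (cells r i - W)) + dt))"

definition truncation_consistent ::
  "(real^'n) set \<Rightarrow> (real^'n \<Rightarrow> real^'n) \<Rightarrow> (real^'n \<Rightarrow> real^'n) \<Rightarrow> real \<Rightarrow> bool" where
  "truncation_consistent K f R \<epsilon> \<longleftrightarrow> (\<forall>T w t x \<sigma> \<eta>.
     classical_solution K f R \<epsilon> T w \<and> 0 \<le> t \<and> t < T \<and> 0 < \<sigma> \<and> 0 < \<eta> \<longrightarrow>
     (\<exists>\<delta>>0. \<forall>dt dx r.
        0 < dx \<and> dt = \<sigma> * dx \<and> dt < \<delta> \<and> staggered_step K f R \<epsilon> dt dx r \<and>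
        (\<forall>j. cells r j = cell_average (w t) (x + of_int j * dx) dx) \<longrightarrow>
        norm ((1 / dt) *\<^sub>R (new r 0 - cell_average (w (t + dt)) x dx)) \<le> \<eta>))"

definition finite_volume_consistent ::
  "(real^'n) set \<Rightarrow> (real^'n \<Rightarrow> real^'n) \<Rightarrow> (real^'n \<Rightarrow> real^'n) \<Rightarrow> real \<Rightarrow> bool" where
  "finite_volume_consistent K f R \<epsilon> \<longleftrightarrow>
     conservative_form K f R \<epsilon> \<and> flux_consistent K f R \<epsilon> \<and>
     source_consistent K f R \<epsilon> \<and> truncation_consistent K f R \<epsilon>"

definition lax_friedrichs_flux ::
  "(real^'k \<Rightarrow> real^'k) \<Rightarrow> real \<Rightarrow> real \<Rightarrow> real^'k \<Rightarrow> real^'k \<Rightarrow> real^'k" where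
  "lax_friedrichs_flux \<phi> dt dx a b = (1 / 2) *\<^sub>R (\<phi> a + \<phi> b) - (dx / (2 * dt)) *\<^sub>R (b - a)"

definition richtmyer_state ::
  "(real^'k \<Rightarrow> real^'k) \<Rightarrow> real \<Rightarrow> real \<Rightarrow> real^'k \<Rightarrow> real^'k \<Rightarrow> real^'k" where
  "richtmyer_state \<phi> dt dx a b = (1 / 2) *\<^sub>R (a + b) - (dt / (2 * dx)) *\<^sub>R (\<phi> b - \<phi> a)"

definition richtmyer_flux ::
  "(real^'k \<Rightarrow> real^'k) \<Rightarrow> real \<Rightarrow> real \<Rightarrow> real^'k \<Rightarrow> real^'k \<Rightarrow> real^'k" where
  "richtmyer_flux \<phi> dt dx a b = \<phi> (richtmyer_state \<phi> dt dx a b)"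

definition force_flux ::
  "(real^'k \<Rightarrow> real^'k) \<Rightarrow> real \<Rightarrow> real \<Rightarrow> real^'k \<Rightarrow> real^'k \<Rightarrow> real^'k" where
  "force_flux \<phi> dt dx a b =
     (1 / 2) *\<^sub>R (lax_friedrichs_flux \<phi> dt dx a b + richtmyer_flux \<phi> dt dx a b)"

definition force_update ::
  "(real^'k \<Rightarrow> real^'k) \<Rightarrow> real \<Rightarrow> real \<Rightarrow> (int \<Rightarrow> real^'k) \<Rightarrow> int \<Rightarrow> real^'k" where
  "force_update \<phi> dt dx u j = u j - (dt / dx) *\<^sub>R
     (force_flux \<phi> dt dx (u j) (u (j + 1)) - force_flux \<phi> dt dx (u (j - 1)) (u j))"

definition consistent_two_point_flux ::
  "(real^'k) set \<Rightarrow> (real^'k \<Rightarrow> real^'k) \<Rightarrow> (real^'k \<Rightarrow> real^'k \<Rightarrow> real^'k) \<Rightarrow> bool" where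
  "consistent_two_point_flux S \<phi> g \<longleftrightarrow> (\<forall>V\<in>S. g V V = \<phi> V \<and>
     (\<exists>L. \<exists>\<delta>>0. \<forall>a b. norm (a - V) < \<delta> \<and> norm (b - V) < \<delta> \<longrightarrow>
        norm (g a b - \<phi> V) \<le> L * (norm (a - V) + norm (b - V))))"

text \<open>Lax--Richtmyer stability in \<open>\<ell>\<^sup>2\<close> of the FORCE scheme for the linear system with matrix
  \<open>A\<close>: the powers of the one-step operator are uniformly bounded.\<close>

definition force_l2_stable :: "real^'k^'k \<Rightarrow> real \<Rightarrow> real \<Rightarrow> bool" where
  "force_l2_stable A dt dx \<longleftrightarrow> (\<exists>C. \<forall>u::int \<Rightarrow> real^'k.
     (\<lambda>j. (norm (u j))\<^sup>2) summable_on UNIV \<longrightarrow>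
     (\<forall>m. (\<lambda>j. (norm ((force_update (\<lambda>v. A *v v) dt dx ^^ m) u j))\<^sup>2) summable_on UNIV \<and>
          (\<Sum>\<^sub>\<infinity>j. (norm ((force_update (\<lambda>v. A *v v) dt dx ^^ m) u j))\<^sup>2)
            \<le> C * (\<Sum>\<^sub>\<infinity>j. (norm (u j))\<^sup>2)))"

text \<open>The characteristic speeds of \<open>A\<close> are dominated by those of the relaxation system on \<open>S\<close>.\<close>

definition subcharacteristic ::
  "(real^'n \<Rightarrow> real^'n) \<Rightarrow> (real^'n) set \<Rightarrow> real^'k^'k \<Rightarrow> bool" where
  "subcharacteristic f S A \<longleftrightarrow> (\<forall>\<mu>. eigenvalue A \<mu> \<longrightarrow>
     (\<exists>W\<in>S. \<exists>l. eigenvalue (jacobian f (at W)) l \<and> \<bar>\<mu>\<bar> \<le> \<bar>l\<bar>))"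

end

theory Submission
  imports Defs
begin

text \<open>On \<open>K\<close> the source is the displacement towards equilibrium. Let \<open>equilibrate W\<close> be the equilibrium
state with the same conserved part \<open>M1 W\<close>; then \<open>R W = equilibrate W - W\<close>, because both sides have
\<open>M1\<close>-component \<open>0\<close> and \<open>M2\<close>-component \<open>Q (M1 W) - M2 W\<close>. Neither the relaxation equation nor the
implicit source changes \<open>M1 W\<close>, hence \<open>equilibrate\<close> is constant along each of them, and both can be
solved explicitly: they move a state along the segment to its equilibrium by the fractions
\<open>1 - exp (- dt / (2 \<epsilon>))\<close> and \<open>dt / (2 \<epsilon> + dt)\<close> (\<open>relaxation_solution_eq\<close>,
\<open>implicit_relaxation_eq\<close>). The half-step states, the numerical flux and the numerical source thus
become explicit functions of the neighbouring cell values (\<open>staggered_step_values\<close>), and the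
one-sided relaxations on either side of a node agree, which gives the conservative form.

For consistency, fix \<open>\<epsilon>\<close> and \<open>\<sigma> = dt / dx\<close>. Both fractions are differentiable functions of \<open>dt\<close> that
vanish at \<open>dt = 0\<close>. As \<open>Q\<close> is smooth and \<open>f\<close> is differentiable at every \<open>W\<close> in \<open>K\<close>, the numerical flux
\<open>F(a, b, dt)\<close> is differentiable at \<open>(W, W, 0)\<close>; moreover \<open>F(a, a, 0) = f a\<close> for every \<open>a\<close>. A
differentiable function has a linear bound near a point, which is the first-order agreement of the
flux with \<open>f\<close>; the source is treated alike. For the truncation error at \<open>x\<close>, put \<open>v = \<partial>\<^sub>x w\<close> and
let \<open>c(k)\<close> be the average of a classical solution over the cell centred at \<open>x + k dx\<close>. Then
\<open>c(k) = W + k dx v + o(dx)\<close> with \<open>W = w t x\<close>, and by the chain rule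
\<open>(F(c(0), c(1), dt) - F(c(-1), c(0), dt)) / dx\<close> tends to
\<open>F'(0, v, \<sigma>) - F'(-v, 0, \<sigma>) = F'(v, v, 0)\<close>, where \<open>F'\<close> is the derivative at \<open>(W, W, 0)\<close>.
Differentiating \<open>F(a, a, 0) = f a\<close> along \<open>a = w t y\<close> identifies this limit as \<open>\<partial>\<^sub>x f(w)\<close>
(\<open>truncation_error_limit\<close>).

In the stiff limit both fractions tend to \<open>1\<close>, so every relaxed state tends to its equilibrium. The
\<open>M1\<close>-part of the half-step becomes the Richtmyer predictor for the equilibrium flux, and the
\<open>M1\<close>-part of the numerical flux becomes the FORCE flux (\<open>half_value_stiff_limit\<close>,
\<open>flux_value_stiff_limit\<close>); the \<open>M1\<close>-part of the source vanishes identically.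

For stability, diagonalise the matrix. In each characteristic field with Courant number \<open>\<nu>\<close> the FORCE
scheme has the coefficients \<open>((1 + \<nu>) / 2)\<^sup>2\<close>, \<open>(1 - \<nu>\<^sup>2) / 2\<close>, \<open>((1 - \<nu>) / 2)\<^sup>2\<close>, which sum to \<open>1\<close>
and are nonnegative when \<open>\<bar>\<nu>\<bar> \<le> 1\<close>, as the CFL condition and the subcharacteristic bound
ensure. The update is then a convex combination of shifts, a contraction of \<open>\<ell>\<^sup>2\<close>, and
the change of basis costs only a fixed factor (\<open>force_l2_stable_if_cfl\<close>).\<close>

section \<open>Differentiability and difference quotients\<close>

lemma smooth_on_imp_differentiable:
  assumes "smooth_on g S" "x \<in> S"
  shows "g differentiable (at x)"
proof -
  have "Ck_on (Suc 0) g S"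
    using assms(1) unfolding smooth_on_def by blast
  then show ?thesis
    using assms(2) by simp
qed

lemma differentiable_imp_locally_linear_bound:
  fixes g :: "'a::real_normed_vector \<Rightarrow> 'b::real_normed_vector"
  assumes "g differentiable (at p)"
  obtains L d where "0 < d" "0 \<le> L" "\<And>q. norm (q - p) < d \<Longrightarrow> norm (g q - g p) \<le> L * norm (q - p)"
proof -
  obtain g' where g': "(g has_derivative g') (at p)"
    using assms unfolding differentiable_def by blast
  then obtain d where d: "0 < d"
    "\<And>q. norm (q - p) < d \<Longrightarrow> norm (g q - g p - g' (q - p)) \<le> 1 * norm (q - p)"
    unfolding has_derivative_at_alt by (meson zero_less_one)
  obtain B where B: "0 < B" "\<And>v. norm (g' v) \<le> norm v * B"
    using has_derivative_bounded_linear[OF g'] bounded_linear.pos_bounded by blast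
  have "norm (g q - g p) \<le> (1 + B) * norm (q - p)" if "norm (q - p) < d" for q
  proof -
    have "norm (g q - g p) \<le> norm (g q - g p - g' (q - p)) + norm (g' (q - p))"
      by (metis diff_add_cancel norm_triangle_ineq)
    then show ?thesis
      using d(2)[OF that] B(2)[of "q - p"] by (simp add: algebra_simps)
  qed
  then show ?thesis
    using that[of d "1 + B"] d(1) B(1) by simp
qed

text \<open>Chain rule along a curve that need not be defined at its starting point. Cell averages over cells of
width \<open>h\<close> are such curves: they converge as \<open>h \<rightarrow> 0\<close> but carry no useful value at \<open>h = 0\<close>.\<close>

lemma has_derivative_right_quotient:
  fixes G :: "'a::real_normed_vector \<Rightarrow> 'b::real_normed_vector" and X :: "real \<Rightarrow> 'a"
  assumes G: "(G has_derivative G') (at p)"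
    and X: "((\<lambda>h. (1 / h) *\<^sub>R (X h - p)) \<longlongrightarrow> v) (at_right 0)"
  shows "((\<lambda>h. (1 / h) *\<^sub>R (G (X h) - G p)) \<longlongrightarrow> G' v) (at_right 0)"
proof -
  have right: "(Z has_derivative (\<lambda>h. h *\<^sub>R c)) (at 0 within {0..}) \<longleftrightarrow>
      ((\<lambda>h. (1 / h) *\<^sub>R (Z h - Z 0)) \<longlongrightarrow> c) (at_right 0)"
    for Z :: "real \<Rightarrow> 'c::real_normed_vector" and c
  proof -
    have "(Z has_derivative (\<lambda>h. h *\<^sub>R c)) (at 0 within {0..}) \<longleftrightarrow>
        ((\<lambda>h. norm (Z h - Z 0 - h *\<^sub>R c) / norm h) \<longlongrightarrow> 0) (at_right 0)"
      by (simp add: has_derivative_iff_norm at_within_Ici_at_right bounded_linear_scaleR_left)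
    also have "\<dots> \<longleftrightarrow> ((\<lambda>h. norm ((1 / h) *\<^sub>R (Z h - Z 0) - c)) \<longlongrightarrow> 0) (at_right 0)"
    proof (rule filterlim_cong[OF refl refl])
      show "\<forall>\<^sub>F h in at_right 0. norm (Z h - Z 0 - h *\<^sub>R c) / norm h
          = norm ((1 / h) *\<^sub>R (Z h - Z 0) - c)"
        using eventually_at_right_less[of 0]
      proof eventually_elim
        case (elim h)
        then have "(1 / h) *\<^sub>R (Z h - Z 0) - c = (1 / h) *\<^sub>R (Z h - Z 0 - h *\<^sub>R c)"
          by (simp add: scaleR_diff_right)
        then show ?case
          using elim by (simp add: divide_inverse mult.commute)
      qed
    qed
    also have "\<dots> \<longleftrightarrow> ((\<lambda>h. (1 / h) *\<^sub>R (Z h - Z 0)) \<longlongrightarrow> c) (at_right 0)"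
      by (simp add: tendsto_norm_zero_iff LIM_zero_iff)
    finally show ?thesis .
  qed
  define Y where "Y h = (if h = 0 then p else X h)" for h :: real
  have Y: "\<forall>\<^sub>F h in at_right 0. Y h = X h"
    using eventually_at_right_less[of 0] by eventually_elim (simp add: Y_def)
  have "((\<lambda>h. (1 / h) *\<^sub>R (Y h - Y 0)) \<longlongrightarrow> v) (at_right 0)"
    by (rule Lim_transform_eventually[OF X])
      (use Y in eventually_elim, simp add: Y_def)
  then have "(Y has_derivative (\<lambda>h. h *\<^sub>R v)) (at 0 within {0..})"
    using right by blast
  moreover have "(G has_derivative G') (at (Y 0) within Y ` {0..})"
    using G has_derivative_at_withinI by (auto simp: Y_def)
  ultimately have "((G \<circ> Y) has_derivative (G' \<circ> (\<lambda>h. h *\<^sub>R v))) (at 0 within {0..})"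
    by (rule diff_chain_within)
  then have "((\<lambda>h. (1 / h) *\<^sub>R (G (Y h) - G (Y 0))) \<longlongrightarrow> G' v) (at_right 0)"
    using right[of "G \<circ> Y" "G' v"] has_derivative_bounded_linear[OF G]
    by (simp add: o_def linear_cmul bounded_linear.linear)
  then show ?thesis
    by (rule Lim_transform_eventually)
      (use Y in eventually_elim, simp add: Y_def)
qed

lemma tendsto_of_right_quotient:
  fixes X :: "real \<Rightarrow> 'a::real_normed_vector"
  assumes "((\<lambda>h. (1 / h) *\<^sub>R (X h - p)) \<longlongrightarrow> v) (at_right 0)"
  shows "(X \<longlongrightarrow> p) (at_right 0)"
proof -
  have "((\<lambda>h. p + h *\<^sub>R ((1 / h) *\<^sub>R (X h - p))) \<longlongrightarrow> p + 0 *\<^sub>R v) (at_right 0)"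
    by (intro tendsto_intros assms)
  then have lim: "((\<lambda>h. p + h *\<^sub>R ((1 / h) *\<^sub>R (X h - p))) \<longlongrightarrow> p) (at_right 0)"
    by simp
  show ?thesis
  proof (rule Lim_transform_eventually[OF lim])
    show "\<forall>\<^sub>F h in at_right 0. p + h *\<^sub>R ((1 / h) *\<^sub>R (X h - p)) = X h"
      using eventually_at_right_less[of 0] by eventually_elim simp
  qed
qed

section \<open>Cell averages of smooth functions\<close>

lemma cell_average_diff:
  assumes "continuous_on UNIV g" "continuous_on UNIV h"
  shows "cell_average (\<lambda>y. g y - h y) x dx = cell_average g x dx - cell_average h x dx"
  unfolding cell_average_def
  by (subst integral_diff)
    (auto intro!: integrable_continuous_real continuous_on_subset[OF assms(1)]
      continuous_on_subset[OF assms(2)] simp: scaleR_diff_right)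

lemma cell_average_affine:
  assumes "0 < dx"
  shows "cell_average (\<lambda>y. c + (y - z) *\<^sub>R v) x dx = c + (x - z) *\<^sub>R v"
proof -
  let ?a = "x - dx / 2" and ?b = "x + dx / 2"
  have le: "?a \<le> ?b"
    using assms by simp
  have "((\<lambda>y. y - z) has_integral (?b - z)\<^sup>2 / 2 - (?a - z)\<^sup>2 / 2) {?a..?b}"
    using le
    by (intro fundamental_theorem_of_calculus)
      (auto intro!: derivative_eq_intros simp: has_real_derivative_iff_has_vector_derivative[symmetric])
  then have "((\<lambda>y. (y - z) *\<^sub>R v) has_integral ((?b - z)\<^sup>2 / 2 - (?a - z)\<^sup>2 / 2) *\<^sub>R v) {?a..?b}"
    by (rule has_integral_scaleR_left)
  moreover have "((\<lambda>y. c) has_integral (?b - ?a) *\<^sub>R c) {?a..?b}"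
    using has_integral_const_real[of c ?a ?b] le by simp
  ultimately have "((\<lambda>y. c + (y - z) *\<^sub>R v) has_integral
      (?b - ?a) *\<^sub>R c + ((?b - z)\<^sup>2 / 2 - (?a - z)\<^sup>2 / 2) *\<^sub>R v) {?a..?b}"
    by (rule has_integral_add[rotated])
  moreover have "(?b - z)\<^sup>2 / 2 - (?a - z)\<^sup>2 / 2 = dx * (x - z)"
    by (simp add: power2_eq_square field_simps)
  ultimately show ?thesis
    using assms by (simp add: cell_average_def integral_unique scaleR_add_right)
qed

lemma norm_cell_average_le:
  assumes "0 < dx" "continuous_on UNIV g"
    and "\<And>y. \<bar>y - x\<bar> \<le> dx / 2 \<Longrightarrow> norm (g y) \<le> B"
  shows "norm (cell_average g x dx) \<le> B"
proof -
  have "norm (integral {x - dx / 2..x + dx / 2} g) \<le> B * (x + dx / 2 - (x - dx / 2))"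
  proof (rule integral_bound)
    show "continuous_on {x - dx / 2..x + dx / 2} g"
      using assms(2) continuous_on_subset by blast
    show "norm (g y) \<le> B" if "y \<in> {x - dx / 2..x + dx / 2}" for y
      using that by (intro assms(3) abs_leI) auto
  qed (use assms(1) in simp)
  then show ?thesis
    using assms(1) by (simp add: cell_average_def field_simps)
qed

text \<open>An affine function has its value at the centre of the cell as its average, so the claim reduces to
averaging the remainder of the first-order expansion at \<open>x\<close>, which is \<open>o(dx)\<close> uniformly on a cell
that stays within \<open>(\<bar>k\<bar> + 1) dx\<close> of \<open>x\<close>.\<close>

lemma cell_average_first_order:
  fixes g :: "real \<Rightarrow> real^'n"
  assumes cont: "continuous_on UNIV g"
    and deriv: "(g has_vector_derivative g') (at x)"
  shows "((\<lambda>dx. (1 / dx) *\<^sub>R (cell_average g (x + k * dx) dx - g x)) \<longlongrightarrow> k *\<^sub>R g') (at_right 0)"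
proof (rule tendstoI)
  fix e :: real
  assume e: "0 < e"
  define m where "m = \<bar>k\<bar> + 1"
  have m: "1 \<le> m"
    by (simp add: m_def)
  obtain d where d: "0 < d"
    "\<And>y. norm (y - x) < d \<Longrightarrow> norm (g y - g x - (y - x) *\<^sub>R g') \<le> e / (2 * m) * norm (y - x)"
    using deriv e m unfolding has_vector_derivative_def has_derivative_at_alt
    by (metis zero_less_divide_iff zero_less_mult_iff zero_less_numeral less_le_trans zero_less_one)
  have "\<forall>\<^sub>F dx in at_right 0. dx \<in> {0<..<d / m}"
    using d(1) m by (intro eventually_at_right_real) simp
  then show "\<forall>\<^sub>F dx in at_right 0.
      dist ((1 / dx) *\<^sub>R (cell_average g (x + k * dx) dx - g x)) (k *\<^sub>R g') < e"
  proof eventually_elim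
    case (elim dx)
    then have dx: "0 < dx" "m * dx < d"
      using m by (auto simp: field_simps)
    let ?h = "\<lambda>y. g y - (g x + (y - x) *\<^sub>R g')"
    have conth: "continuous_on UNIV (\<lambda>y. g x + (y - x) *\<^sub>R g')"
      by (intro continuous_intros)
    have "norm (cell_average ?h (x + k * dx) dx) \<le> e / 2 * dx"
    proof (rule norm_cell_average_le[OF dx(1)])
      show "continuous_on UNIV ?h"
        by (intro continuous_intros cont)
      fix y
      assume y: "\<bar>y - (x + k * dx)\<bar> \<le> dx / 2"
      have "\<bar>y - x\<bar> \<le> \<bar>y - (x + k * dx)\<bar> + \<bar>k * dx\<bar>"
        by linarith
      also have "\<dots> \<le> m * dx"
        using y dx(1) by (simp add: m_def abs_mult distrib_right)
      finally have yx: "\<bar>y - x\<bar> \<le> m * dx" .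
      then have "norm (?h y) \<le> e / (2 * m) * \<bar>y - x\<bar>"
        using d(2)[of y] dx by (simp add: diff_diff_eq)
      also have "\<dots> \<le> e / (2 * m) * (m * dx)"
        using yx e m by (intro mult_left_mono) auto
      also have "\<dots> = e / 2 * dx"
        using m by simp
      finally show "norm (?h y) \<le> e / 2 * dx" .
    qed
    moreover have "cell_average ?h (x + k * dx) dx
        = cell_average g (x + k * dx) dx - g x - dx *\<^sub>R (k *\<^sub>R g')"
      by (simp add: cell_average_diff[OF cont conth] cell_average_affine[OF dx(1)] mult.commute)
    moreover have "(1 / dx) *\<^sub>R (cell_average g (x + k * dx) dx - g x) - k *\<^sub>R g'
        = (1 / dx) *\<^sub>R (cell_average g (x + k * dx) dx - g x - dx *\<^sub>R (k *\<^sub>R g'))"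
      using dx(1) by (simp add: scaleR_diff_right)
    ultimately have "norm ((1 / dx) *\<^sub>R (cell_average g (x + k * dx) dx - g x) - k *\<^sub>R g')
        \<le> (1 / dx) * (e / 2 * dx)"
      using dx(1) mult_left_mono[of _ "e / 2 * dx" "1 / dx"] by simp
    also have "\<dots> = e / 2"
      using dx(1) by simp
    finally have "norm ((1 / dx) *\<^sub>R (cell_average g (x + k * dx) dx - g x) - k *\<^sub>R g') \<le> e / 2" .
    then show ?case
      using e by (simp add: dist_norm)
  qed
qed

text \<open>Joint continuity of the time derivative makes \<open>w (t + dt) y - w t y - dt wt t x\<close> an \<open>o(dt)\<close>
uniformly for \<open>y\<close> in the shrinking cell, by the mean value inequality for
\<open>\<lambda>s. w s y - s wt t x\<close>.\<close>

lemma cell_average_time_increment: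
  fixes w :: "real \<Rightarrow> real \<Rightarrow> real^'n"
  assumes wt_cont: "continuous_on ({0..T} \<times> UNIV) (\<lambda>(s, y). wt s y)"
    and deriv: "\<And>s y. s \<in> {0..T} \<Longrightarrow>
      ((\<lambda>s. w s y) has_vector_derivative wt s y) (at s within {0..T})"
    and cont: "\<And>s. s \<in> {0..T} \<Longrightarrow> continuous_on UNIV (w s)"
    and t: "0 \<le> t" "t < T" and \<sigma>: "0 < \<sigma>"
  shows "((\<lambda>dx. (1 / (\<sigma> * dx)) *\<^sub>R
      (cell_average (w (t + \<sigma> * dx)) x dx - cell_average (w t) x dx)) \<longlongrightarrow> wt t x) (at_right 0)"
proof (rule tendstoI)
  fix e :: real
  assume e: "0 < e"
  have "(t, x) \<in> {0..T} \<times> UNIV" and "0 < e / 2"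
    using t e by auto
  then obtain d where d': "0 < d"
    "\<And>q. q \<in> {0..T} \<times> UNIV \<Longrightarrow> dist q (t, x) < d \<Longrightarrow>
      dist (case q of (s, y) \<Rightarrow> wt s y) (case (t, x) of (s, y) \<Rightarrow> wt s y) < e / 2"
    using wt_cont unfolding continuous_on_iff by meson
  then have d: "0 < d"
    "\<And>s y. s \<in> {0..T} \<Longrightarrow> dist (s, y) (t, x) < d \<Longrightarrow> dist (wt s y) (wt t x) < e / 2"
    using d'(2)[of "(s, y)" for s y] by auto
  have "\<forall>\<^sub>F dx in at_right 0. dx \<in> {0<..<min (d / (1 + \<sigma>)) ((T - t) / \<sigma>)}"
    using d(1) t \<sigma> by (intro eventually_at_right_real) simp
  then show "\<forall>\<^sub>F dx in at_right 0. dist ((1 / (\<sigma> * dx)) *\<^sub>R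
      (cell_average (w (t + \<sigma> * dx)) x dx - cell_average (w t) x dx)) (wt t x) < e"
  proof eventually_elim
    case (elim dx)
    then have dx: "0 < dx" "dx + \<sigma> * dx < d" "t + \<sigma> * dx < T"
      using \<sigma> by (auto simp: field_simps)
    define dt where "dt = \<sigma> * dx"
    have dt: "0 < dt"
      using dx \<sigma> by (simp add: dt_def)
    \<comment> \<open>The zero slope gives the subtracted constant the affine form whose cell average is known.\<close>
    let ?h = "\<lambda>y. (w (t + dt) y - w t y) - (dt *\<^sub>R wt t x + (y - x) *\<^sub>R 0)"
    have c1: "continuous_on UNIV (\<lambda>y. w (t + dt) y - w t y)"
      using t dx dt by (intro continuous_intros cont) (auto simp: dt_def)
    have c2: "continuous_on UNIV (\<lambda>y::real. dt *\<^sub>R wt t x + (y - x) *\<^sub>R 0)"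
      by (intro continuous_intros)
    have "norm (cell_average ?h x dx) \<le> e / 2 * dt"
    proof (rule norm_cell_average_le[OF dx(1)])
      show "continuous_on UNIV ?h"
        by (rule continuous_on_diff[OF c1 c2])
      fix y
      assume y: "\<bar>y - x\<bar> \<le> dx / 2"
      have sub: "{t..t + dt} \<subseteq> {0..T}"
        using t dx dt by (auto simp: dt_def)
      have "norm ((w (t + dt) y - (t + dt) *\<^sub>R wt t x) - (w t y - t *\<^sub>R wt t x))
          \<le> e / 2 * norm (t + dt - t)"
      proof (rule differentiable_bound[where S = "{t..t + dt}" and f = "\<lambda>s. w s y - s *\<^sub>R wt t x"
            and f' = "\<lambda>s h. h *\<^sub>R (wt s y - wt t x)"])
        fix s
        assume s: "s \<in> {t..t + dt}"
        have "((\<lambda>s. w s y) has_vector_derivative wt s y) (at s within {t..t + dt})"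
          using deriv[of s y] s sub has_vector_derivative_within_subset by blast
        then show "((\<lambda>s. w s y - s *\<^sub>R wt t x) has_derivative (\<lambda>h. h *\<^sub>R (wt s y - wt t x)))
            (at s within {t..t + dt})"
          unfolding has_vector_derivative_def
          by (auto intro!: derivative_eq_intros simp: scaleR_diff_right)
        have "dist (s, y) (t, x) \<le> \<bar>s - t\<bar> + \<bar>y - x\<bar>"
          using norm_Pair_le[of "s - t" "y - x"] by (simp add: dist_norm)
        also have "\<dots> < d"
          using s y dx by (auto simp: dt_def)
        finally have le: "norm (wt s y - wt t x) \<le> e / 2"
          using d(2)[of s y] s sub by (auto simp: dist_norm)
        show "onorm (\<lambda>h. h *\<^sub>R (wt s y - wt t x)) \<le> e / 2"
        proof (rule onorm_le)
          show "norm (h *\<^sub>R (wt s y - wt t x)) \<le> e / 2 * norm h" for h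
            using mult_right_mono[OF le, of "\<bar>h\<bar>"] by (simp add: mult.commute)
        qed
      qed (use dt in auto)
      then show "norm (?h y) \<le> e / 2 * dt"
        using dt by (simp add: algebra_simps)
    qed
    moreover have "cell_average ?h x dx
        = cell_average (w (t + dt)) x dx - cell_average (w t) x dx - dt *\<^sub>R wt t x"
      using cell_average_affine[OF dx(1), of "dt *\<^sub>R wt t x" x 0 x]
      by (subst cell_average_diff[OF c1 c2], subst cell_average_diff)
        (use cont t dx dt in \<open>auto simp: dt_def\<close>)
    moreover have "(1 / dt) *\<^sub>R (cell_average (w (t + dt)) x dx - cell_average (w t) x dx) - wt t x
        = (1 / dt) *\<^sub>R (cell_average (w (t + dt)) x dx - cell_average (w t) x dx - dt *\<^sub>R wt t x)"
      using dt by (simp add: scaleR_diff_right)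
    ultimately have "norm ((1 / dt) *\<^sub>R (cell_average (w (t + dt)) x dx - cell_average (w t) x dx)
        - wt t x) \<le> (1 / dt) * (e / 2 * dt)"
      using dt mult_left_mono[of _ "e / 2 * dt" "1 / dt"] by simp
    also have "\<dots> = e / 2"
      using dt by simp
    finally have "norm ((1 / dt) *\<^sub>R (cell_average (w (t + dt)) x dx - cell_average (w t) x dx)
        - wt t x) \<le> e / 2" .
    then show ?case
      using e by (simp add: dist_norm dt_def)
  qed
qed

section \<open>The FORCE scheme\<close>

lemma force_flux_eq:
  assumes "0 < dt" "0 < dx"
  shows "force_flux \<phi> dt dx a b = (1 / 4) *\<^sub>R
    (2 *\<^sub>R \<phi> (richtmyer_state \<phi> dt dx a b) + \<phi> b + \<phi> a - (dx / dt) *\<^sub>R (b - a))"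
proof -
  have "force_flux \<phi> dt dx a b $ i = ((1 / 4) *\<^sub>R
    (2 *\<^sub>R \<phi> (richtmyer_state \<phi> dt dx a b) + \<phi> b + \<phi> a - (dx / dt) *\<^sub>R (b - a))) $ i" for i
    using assms unfolding force_flux_def lax_friedrichs_flux_def richtmyer_flux_def
    by (simp add: field_simps)
  then show ?thesis
    by (simp add: vec_eq_iff)
qed

text \<open>As a function of both arguments the FORCE flux is differentiable on the diagonal, and
differentiability at one point suffices for the linear bound there.\<close>

lemma consistent_force_flux:
  fixes \<phi> :: "real^'k \<Rightarrow> real^'k"
  assumes "\<And>V. V \<in> S \<Longrightarrow> \<phi> differentiable (at V)"
  shows "consistent_two_point_flux S \<phi> (force_flux \<phi> dt dx)"
  unfolding consistent_two_point_flux_def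
proof (intro ballI conjI)
  fix V
  assume V: "V \<in> S"
  have rich: "richtmyer_state \<phi> dt dx V V = V"
    by (simp add: richtmyer_state_def flip: scaleR_2)
  show eq: "force_flux \<phi> dt dx V V = \<phi> V"
    by (simp add: force_flux_def lax_friedrichs_flux_def richtmyer_flux_def rich flip: scaleR_2)
  let ?g = "\<lambda>q. force_flux \<phi> dt dx (fst q) (snd q)"
  have fst: "fst differentiable (at (V, V))" and snd: "snd differentiable (at (V, V))"
    by (simp_all add: bounded_linear_imp_differentiable bounded_linear_fst bounded_linear_snd)
  have \<phi>: "(\<lambda>q. \<phi> (X q)) differentiable (at (V, V))"
    if "X (V, V) = V" "X differentiable (at (V, V))" for X
    using that differentiable_compose[of \<phi> X "(V, V)"] assms[OF V] by simp
  have rich_diff: "(\<lambda>q. richtmyer_state \<phi> dt dx (fst q) (snd q)) differentiable (at (V, V))"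
    unfolding richtmyer_state_def
    by (intro differentiable_diff differentiable_scaleR differentiable_add differentiable_const
        fst snd \<phi>) simp_all
  have "?g differentiable (at (V, V))"
    unfolding force_flux_def lax_friedrichs_flux_def richtmyer_flux_def
    by (intro differentiable_diff differentiable_scaleR differentiable_add differentiable_const
        fst snd \<phi> rich_diff) (simp_all add: rich)
  then obtain d L where d: "0 < d" "0 \<le> L"
    "\<And>q. norm (q - (V, V)) < d \<Longrightarrow> norm (?g q - ?g (V, V)) \<le> L * norm (q - (V, V))"
    by (rule differentiable_imp_locally_linear_bound) blast
  have "norm (force_flux \<phi> dt dx a b - \<phi> V) \<le> L * (norm (a - V) + norm (b - V))"
    if "norm (a - V) < d / 2" "norm (b - V) < d / 2" for a b
  proof -
    have le: "norm ((a, b) - (V, V)) \<le> norm (a - V) + norm (b - V)"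
      using norm_Pair_le[of "a - V" "b - V"] by simp
    then have "norm (?g (a, b) - ?g (V, V)) \<le> L * norm ((a, b) - (V, V))"
      using that by (intro d(3)) simp
    also have "\<dots> \<le> L * (norm (a - V) + norm (b - V))"
      by (rule mult_left_mono[OF le d(2)])
    finally show ?thesis
      by (simp add: eq)
  qed
  then show "\<exists>L. \<exists>\<delta>>0. \<forall>a b. norm (a - V) < \<delta> \<and> norm (b - V) < \<delta> \<longrightarrow>
      norm (force_flux \<phi> dt dx a b - \<phi> V) \<le> L * (norm (a - V) + norm (b - V))"
    using d(1) by (intro exI[of _ L] exI[of _ "d / 2"]) auto
qed

definition diagonal_matrix :: "real^'k^'k \<Rightarrow> bool" where
  "diagonal_matrix D \<longleftrightarrow> (\<forall>i j. i \<noteq> j \<longrightarrow> D $ i $ j = 0)"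

lemma diagonal_matrix_vector_mult:
  assumes "diagonal_matrix D"
  shows "(D *v x) $ i = D $ i $ i * x $ i"
proof -
  have "(D *v x) $ i = (\<Sum>j\<in>UNIV. D $ i $ j * x $ j)"
    by (simp add: matrix_vector_mult_def)
  also have "\<dots> = (\<Sum>j\<in>{i}. D $ i $ j * x $ j)"
    using assms by (intro sum.mono_neutral_right) (auto simp: diagonal_matrix_def)
  finally show ?thesis by simp
qed

text \<open>The fields decouple, and \<open>\<nu> i\<close> is the Courant number of field \<open>i\<close>. In each field the scheme is a
three-point average whose nonnegativity under \<open>\<bar>\<nu> i\<bar> \<le> 1\<close> is visible from the coefficients.\<close>

lemma force_update_diagonal:
  fixes D :: "real^'k^'k"
  assumes "diagonal_matrix D" "0 < dt" "0 < dx"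
  defines "\<nu> \<equiv> \<lambda>i. dt / dx * D $ i $ i"
  shows "force_update (\<lambda>v. D *v v) dt dx u j $ i
    = ((1 + \<nu> i) / 2)\<^sup>2 * u (j - 1) $ i + (1 - (\<nu> i)\<^sup>2) / 2 * u j $ i
      + ((1 - \<nu> i) / 2)\<^sup>2 * u (j + 1) $ i"
proof -
  have D: "D $ i $ i = \<nu> i * dx / dt"
    using assms(2,3) by (simp add: \<nu>_def)
  show ?thesis
    using assms(2,3)
    by (simp add: force_update_def force_flux_def lax_friedrichs_flux_def richtmyer_flux_def
        richtmyer_state_def diagonal_matrix_vector_mult[OF assms(1)] D)
      (simp add: field_simps power2_eq_square)
qed

lemma convex_combination_square_le:
  fixes a b c x y z :: real
  assumes "0 \<le> a" "0 \<le> b" "0 \<le> c" "a + b + c = 1"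
  shows "(a * x + b * y + c * z)\<^sup>2 \<le> a * x\<^sup>2 + b * y\<^sup>2 + c * z\<^sup>2"
proof -
  have c: "c = 1 - a - b"
    using assms(4) by simp
  have "a * x\<^sup>2 + b * y\<^sup>2 + c * z\<^sup>2 - (a * x + b * y + c * z)\<^sup>2
      = a * b * (x - y)\<^sup>2 + a * c * (x - z)\<^sup>2 + b * c * (y - z)\<^sup>2"
    unfolding c by (simp add: power2_eq_square algebra_simps)
  also have "\<dots> \<ge> 0"
    using assms by simp
  finally show ?thesis by simp
qed

lemma has_sum_finite_sum:
  fixes g :: "'i \<Rightarrow> 'b \<Rightarrow> real"
  assumes "finite I" "\<And>i. i \<in> I \<Longrightarrow> (g i has_sum s i) A"
  shows "((\<lambda>x. \<Sum>i\<in>I. g i x) has_sum (\<Sum>i\<in>I. s i)) A"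
  using assms by (induction I rule: finite_induct) (auto intro!: has_sum_add)

lemma has_sum_int_shift:
  fixes g :: "int \<Rightarrow> real"
  assumes "(g has_sum s) UNIV"
  shows "((\<lambda>j. g (j + k)) has_sum s) UNIV"
proof -
  have "bij_betw (\<lambda>j. j + k) UNIV UNIV"
    by (rule bij_betw_byWitness[where f' = "\<lambda>j. j - k"]) auto
  from has_sum_reindex_bij_betw[OF this, of g s] assms show ?thesis
    by simp
qed

lemma norm_vec_squared: "(norm (x::real^'k))\<^sup>2 = (\<Sum>i\<in>UNIV. (x $ i)\<^sup>2)"
  by (simp add: norm_vec_def L2_set_def sum_nonneg)

text \<open>Jensen's inequality for the square in each field, summed over all cells: every shift of a sequence
has the same \<open>\<ell>\<^sup>2\<close> norm and the three weights sum to \<open>1\<close>.\<close>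

lemma force_update_diagonal_contraction:
  fixes D :: "real^'k^'k"
  assumes diag: "diagonal_matrix D" and mesh: "0 < dt" "0 < dx"
    and cfl: "\<And>i. dt * \<bar>D $ i $ i\<bar> \<le> dx"
    and summable: "(\<lambda>j. (norm (u j))\<^sup>2) summable_on UNIV"
  shows "(\<lambda>j. (norm (force_update (\<lambda>v. D *v v) dt dx u j))\<^sup>2) summable_on UNIV"
    and "(\<Sum>\<^sub>\<infinity>j. (norm (force_update (\<lambda>v. D *v v) dt dx u j))\<^sup>2) \<le> (\<Sum>\<^sub>\<infinity>j. (norm (u j))\<^sup>2)"
proof -
  let ?v = "force_update (\<lambda>v. D *v v) dt dx u"
  define \<nu> where "\<nu> i = dt / dx * D $ i $ i" for i
  define a b c where "a i = ((1 + \<nu> i) / 2)\<^sup>2" and "b i = (1 - (\<nu> i)\<^sup>2) / 2"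
    and "c i = ((1 - \<nu> i) / 2)\<^sup>2" for i
  define h where "h i j = a i * (u (j - 1) $ i)\<^sup>2 + b i * (u j $ i)\<^sup>2 + c i * (u (j + 1) $ i)\<^sup>2"
    for i j
  define s where "s i = (\<Sum>\<^sub>\<infinity>j. (u j $ i)\<^sup>2)" for i
  have abc: "0 \<le> a i" "0 \<le> b i" "0 \<le> c i" "a i + b i + c i = 1" for i
  proof -
    have "\<bar>\<nu> i\<bar> \<le> 1"
      using cfl[of i] mesh by (simp add: \<nu>_def abs_mult)
    then show "0 \<le> b i"
      by (simp add: b_def abs_square_le_1)
    show "a i + b i + c i = 1"
      by (simp add: a_def b_def c_def power2_eq_square field_simps)
  qed (simp_all add: a_def c_def)
  have s: "((\<lambda>j. (u j $ i)\<^sup>2) has_sum s i) UNIV" for i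
  proof -
    have "(\<lambda>j. (u j $ i)\<^sup>2) summable_on UNIV"
    proof (rule summable_on_comparison_test[OF summable])
      fix j
      show "(u j $ i)\<^sup>2 \<le> (norm (u j))\<^sup>2"
        using power_mono[OF component_le_norm_cart[of "u j" i], of 2] by simp
    qed simp
    then show ?thesis
      unfolding s_def by (rule has_sum_infsum)
  qed
  have "(h i has_sum (a i * s i + b i * s i + c i * s i)) UNIV" for i
    unfolding h_def using has_sum_int_shift[OF s[of i], of "-1"] has_sum_int_shift[OF s[of i], of 1]
    by (intro has_sum_add has_sum_cmult_right s) simp_all
  moreover have "a i * s i + b i * s i + c i * s i = s i" for i
    using abc(4)[of i] by (simp flip: distrib_right)
  ultimately have h: "((\<lambda>j. \<Sum>i\<in>UNIV. h i j) has_sum (\<Sum>i\<in>UNIV. s i)) UNIV"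
    by (intro has_sum_finite_sum) simp_all
  have u: "((\<lambda>j. (norm (u j))\<^sup>2) has_sum (\<Sum>i\<in>UNIV. s i)) UNIV"
    unfolding norm_vec_squared by (intro has_sum_finite_sum s) simp
  have le: "(norm (?v j))\<^sup>2 \<le> (\<Sum>i\<in>UNIV. h i j)" for j
    unfolding norm_vec_squared
  proof (rule sum_mono)
    fix i
    show "(?v j $ i)\<^sup>2 \<le> h i j"
      unfolding force_update_diagonal[OF diag mesh] h_def
      using convex_combination_square_le[OF abc] by (simp add: a_def b_def c_def \<nu>_def)
  qed
  show summ: "(\<lambda>j. (norm (?v j))\<^sup>2) summable_on UNIV"
    by (rule summable_on_comparison_test[OF has_sum_imp_summable[OF h] le]) simp
  show "(\<Sum>\<^sub>\<infinity>j. (norm (?v j))\<^sup>2) \<le> (\<Sum>\<^sub>\<infinity>j. (norm (u j))\<^sup>2)"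
    using has_sum_mono[OF has_sum_infsum[OF summ] h le] infsumI[OF u] by simp
qed

lemma force_update_conjugate:
  fixes A D P :: "real^'k^'k"
  assumes "A ** P = P ** D"
  shows "force_update (\<lambda>v. A *v v) dt dx (\<lambda>j. P *v u j) = (\<lambda>j. P *v force_update (\<lambda>v. D *v v) dt dx u j)"
proof -
  have "A *v (P *v x) = P *v (D *v x)" for x
    by (simp add: matrix_vector_mul_assoc assms)
  moreover have "A *v (c *\<^sub>R x) = c *\<^sub>R (A *v x)" "P *v (c *\<^sub>R x) = c *\<^sub>R (P *v x)"
    "D *v (c *\<^sub>R x) = c *\<^sub>R (D *v x)" for c x
    by (simp_all add: matrix_vector_mult_scaleR)
  ultimately show ?thesis
    by (intro ext) (simp only: force_update_def force_flux_def lax_friedrichs_flux_def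
        richtmyer_flux_def richtmyer_state_def matrix_vector_right_distrib
        matrix_vector_mult_diff_distrib)
qed

text \<open>The bound for a diagonal matrix carries over through \<open>u = P v\<close>, where the columns of \<open>P\<close> are
eigenvectors. The constant is made of bounds for \<open>P\<close> and its inverse and does not depend on the
number of steps, because the basis is changed only once in each direction.\<close>

lemma force_l2_stable_if_cfl:
  fixes A :: "real^'k^'k"
  assumes "real_diagonalizable A" and mesh: "0 < dt" "0 < dx"
    and cfl: "\<And>\<mu>. eigenvalue A \<mu> \<Longrightarrow> dt * \<bar>\<mu>\<bar> \<le> dx"
  shows "force_l2_stable A dt dx"
proof -
  obtain P D :: "real^'k^'k" where P: "invertible P" and D: "diagonal_matrix D"
    and A: "A = P ** D ** matrix_inv P"
    using assms(1) unfolding real_diagonalizable_def diagonal_matrix_def by blast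
  let ?N = "matrix_inv P"
  have PN: "P ** ?N = mat 1" and NP: "?N ** P = mat 1"
    using P unfolding invertible_def matrix_inv_def by (metis (mono_tags, lifting) someI_ex)+
  have AP: "A ** P = P ** D"
    by (simp add: A NP flip: matrix_mul_assoc)
  \<comment> \<open>Column \<open>i\<close> of \<open>P\<close> is an eigenvector of \<open>A\<close> for the diagonal entry \<open>D $ i $ i\<close>.\<close>
  have eigen: "dt * \<bar>D $ i $ i\<bar> \<le> dx" for i
  proof (rule cfl)
    have "D *v axis i 1 = D $ i $ i *\<^sub>R axis i 1"
      by (simp add: vec_eq_iff diagonal_matrix_vector_mult[OF D] axis_def)
    then have "A *v (P *v axis i 1) = D $ i $ i *\<^sub>R (P *v axis i 1)"
      by (simp add: matrix_vector_mul_assoc AP matrix_vector_mult_scaleR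
          flip: matrix_vector_mul_assoc[of P D])
    moreover have "P *v axis i 1 \<noteq> 0"
    proof
      assume "P *v axis i 1 = 0"
      then have "?N *v (P *v axis i 1) = 0"
        by simp
      then show False
        by (simp add: matrix_vector_mul_assoc NP)
    qed
    ultimately show "eigenvalue A (D $ i $ i)"
      unfolding eigenvalue_def by blast
  qed
  obtain p where p: "0 < p" "\<And>x. norm (P *v x) \<le> norm x * p"
    using bounded_linear.pos_bounded[OF matrix_vector_mul_bounded_linear[of P]] by blast
  obtain q where q: "0 < q" "\<And>x. norm (?N *v x) \<le> norm x * q"
    using bounded_linear.pos_bounded[OF matrix_vector_mul_bounded_linear[of ?N]] by blast
  have scaled: "(\<lambda>j. (norm (B *v v j))\<^sup>2) summable_on UNIV \<and>
      (\<Sum>\<^sub>\<infinity>j. (norm (B *v v j))\<^sup>2) \<le> b\<^sup>2 * (\<Sum>\<^sub>\<infinity>j. (norm (v j))\<^sup>2)"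
    if B: "\<And>x. norm (B *v x) \<le> norm x * b" and v: "(\<lambda>j. (norm (v j))\<^sup>2) summable_on UNIV"
    for B :: "real^'k^'k" and b and v :: "int \<Rightarrow> real^'k"
  proof -
    have h: "((\<lambda>j. b\<^sup>2 * (norm (v j))\<^sup>2) has_sum b\<^sup>2 * (\<Sum>\<^sub>\<infinity>j. (norm (v j))\<^sup>2)) UNIV"
      by (intro has_sum_cmult_right has_sum_infsum v)
    have le: "(norm (B *v v j))\<^sup>2 \<le> b\<^sup>2 * (norm (v j))\<^sup>2" for j
      using power_mono[OF B[of "v j"], of 2] by (simp add: power_mult_distrib mult.commute)
    have s: "(\<lambda>j. (norm (B *v v j))\<^sup>2) summable_on UNIV"
      by (rule summable_on_comparison_test[OF has_sum_imp_summable[OF h] le]) simp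
    show ?thesis
      using s has_sum_mono[OF has_sum_infsum[OF s] h le] by simp
  qed
  have "(\<lambda>j. (norm ((force_update (\<lambda>v. A *v v) dt dx ^^ m) u j))\<^sup>2) summable_on UNIV \<and>
      (\<Sum>\<^sub>\<infinity>j. (norm ((force_update (\<lambda>v. A *v v) dt dx ^^ m) u j))\<^sup>2)
        \<le> p\<^sup>2 * q\<^sup>2 * (\<Sum>\<^sub>\<infinity>j. (norm (u j))\<^sup>2)"
    if u: "(\<lambda>j. (norm (u j))\<^sup>2) summable_on UNIV" for u :: "int \<Rightarrow> real^'k" and m
  proof -
    define v where "v n = (force_update (\<lambda>v. D *v v) dt dx ^^ n) (\<lambda>j. ?N *v u j)" for n
    have v0: "(\<lambda>j. (norm (v 0 j))\<^sup>2) summable_on UNIV"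
      "(\<Sum>\<^sub>\<infinity>j. (norm (v 0 j))\<^sup>2) \<le> q\<^sup>2 * (\<Sum>\<^sub>\<infinity>j. (norm (u j))\<^sup>2)"
      using scaled[OF q(2) u] by (simp_all add: v_def)
    have v: "(\<lambda>j. (norm (v n j))\<^sup>2) summable_on UNIV \<and>
        (\<Sum>\<^sub>\<infinity>j. (norm (v n j))\<^sup>2) \<le> (\<Sum>\<^sub>\<infinity>j. (norm (v 0 j))\<^sup>2)" for n
    proof (induction n)
      case (Suc n)
      have "v (Suc n) = force_update (\<lambda>v. D *v v) dt dx (v n)"
        by (simp add: v_def)
      then show ?case
        using force_update_diagonal_contraction[OF D mesh eigen, of "v n"] Suc by auto
    qed (simp add: v0)
    have eq: "(force_update (\<lambda>v. A *v v) dt dx ^^ n) u = (\<lambda>j. P *v v n j)" for n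
    proof (induction n)
      case 0
      show ?case
        by (simp add: v_def matrix_vector_mul_assoc PN)
    next
      case (Suc n)
      then show ?case
        by (simp add: force_update_conjugate[OF AP] v_def)
    qed
    have "(\<Sum>\<^sub>\<infinity>j. (norm (P *v v m j))\<^sup>2) \<le> p\<^sup>2 * (\<Sum>\<^sub>\<infinity>j. (norm (v m j))\<^sup>2)"
      using scaled[OF p(2)] v by blast
    also have "\<dots> \<le> p\<^sup>2 * (q\<^sup>2 * (\<Sum>\<^sub>\<infinity>j. (norm (u j))\<^sup>2))"
      using v[of m] v0(2) by (intro mult_left_mono) auto
    finally show ?thesis
      using scaled[OF p(2)] v by (simp add: eq mult.assoc)
  qed
  then show ?thesis
    unfolding force_l2_stable_def by blast
qed

section \<open>The staggered scheme in closed form\<close>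

text \<open>The fractions of the way to equilibrium covered by the relaxation equation in time \<open>dt / 2\<close> and by
the implicit source term.\<close>

definition relax_weight :: "real \<Rightarrow> real \<Rightarrow> real" where
  "relax_weight \<epsilon> dt = 1 - exp (- (dt / 2) / \<epsilon>)"

definition implicit_weight :: "real \<Rightarrow> real \<Rightarrow> real" where
  "implicit_weight \<epsilon> dt = dt / (2 * \<epsilon> + dt)"

lemma relax_weight_0 [simp]: "relax_weight \<epsilon> 0 = 0"
  by (simp add: relax_weight_def)

lemma implicit_weight_0 [simp]: "implicit_weight \<epsilon> 0 = 0"
  by (simp add: implicit_weight_def)

lemma relax_weight_stiff_limit:
  assumes "0 < dt"
  shows "((\<lambda>\<epsilon>. relax_weight \<epsilon> dt) \<longlongrightarrow> 1) (at_right 0)"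
proof -
  have "filterlim (\<lambda>\<epsilon>::real. inverse \<epsilon>) at_top (at_right 0)"
    by (rule filterlim_inverse_at_top_right)
  then have "filterlim (\<lambda>\<epsilon>. - (dt / 2) * inverse \<epsilon>) at_bot (at_right 0)"
    using filterlim_tendsto_neg_mult_at_bot[OF tendsto_const, of "- (dt / 2)"] assms by simp
  then have "((\<lambda>\<epsilon>. exp (- (dt / 2) * inverse \<epsilon>)) \<longlongrightarrow> 0) (at_right 0)"
    by (rule filterlim_compose[OF exp_at_bot])
  then have "((\<lambda>\<epsilon>. 1 - exp (- (dt / 2) * inverse \<epsilon>)) \<longlongrightarrow> 1 - 0) (at_right 0)"
    by (intro tendsto_intros)
  then show ?thesis
    by (simp only: relax_weight_def divide_inverse diff_zero)
qed

lemma implicit_weight_stiff_limit: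
  assumes "0 < dt"
  shows "((\<lambda>\<epsilon>. implicit_weight \<epsilon> dt) \<longlongrightarrow> 1) (at_right 0)"
proof -
  have "((\<lambda>\<epsilon>. dt / (2 * \<epsilon> + dt)) \<longlongrightarrow> dt / (2 * 0 + dt)) (at_right 0)"
    using assms by (intro tendsto_intros) auto
  then show ?thesis
    using assms by (simp add: implicit_weight_def)
qed

lemma differentiable_relax_weight:
  fixes t :: "'p::real_normed_vector \<Rightarrow> real"
  assumes "t differentiable (at p)"
  shows "(\<lambda>q. relax_weight \<epsilon> (t q)) differentiable (at p)"
proof -
  have "(\<lambda>s. relax_weight \<epsilon> s) differentiable (at (t p))"
    unfolding relax_weight_def real_differentiable_def
    by (cases "\<epsilon> = 0") (auto intro!: exI derivative_eq_intros)
  from differentiable_compose[OF this assms] show ?thesis .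
qed

lemma differentiable_implicit_weight:
  fixes t :: "'p::real_normed_vector \<Rightarrow> real"
  assumes "t differentiable (at p)" "2 * \<epsilon> + t p \<noteq> 0"
  shows "(\<lambda>q. implicit_weight \<epsilon> (t q)) differentiable (at p)"
  unfolding implicit_weight_def using assms by (intro derivative_intros) auto

text \<open>The algebra behind the conservative form: the average of two neighbouring half-steps followed by the
second step. Here \<open>c\<close>, \<open>f\<close>, \<open>r\<close> stand for cell values, first-step fluxes and sources, \<open>g\<close> for
second-step fluxes, and \<open>r0\<close> is the source at the new state.\<close>

lemma conservative_rearrangement:
  fixes c0 c1 c2 f0 f1 f2 g0 g1 r0 r1 r2 :: "real^'n"
  assumes "0 < dt" "0 < dx" "0 < \<epsilon>"
  shows "(1 / 2) *\<^sub>R ((1 / 2) *\<^sub>R (c2 + c1) - (dt / (2 * dx)) *\<^sub>R (f2 - f1) + (dt / (2 * \<epsilon>)) *\<^sub>R r2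
        + ((1 / 2) *\<^sub>R (c1 + c0) - (dt / (2 * dx)) *\<^sub>R (f1 - f0) + (dt / (2 * \<epsilon>)) *\<^sub>R r1))
      - (dt / (2 * dx)) *\<^sub>R (g1 - g0) + (dt / (2 * \<epsilon>)) *\<^sub>R r0
    = c1 - (dt / dx) *\<^sub>R
        ((1 / 4) *\<^sub>R (2 *\<^sub>R g1 + f1 + f2 - (dx / dt) *\<^sub>R (c2 - c1))
          - (1 / 4) *\<^sub>R (2 *\<^sub>R g0 + f0 + f1 - (dx / dt) *\<^sub>R (c1 - c0)))
      + dt *\<^sub>R ((1 / (4 * \<epsilon>)) *\<^sub>R (2 *\<^sub>R r0 + r1 + r2))"
  (is "?l = ?r")
proof -
  have "?l $ i = ?r $ i" for i
    using assms by (simp add: divide_simps) (simp add: algebra_simps)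
  then show ?thesis
    by (simp add: vec_eq_iff)
qed

context relaxation_system
begin

definition equilibrate :: "real^'n \<Rightarrow> real^'n" where
  "equilibrate W = equilibrium M1 M2 Q (M1 *v W)"

definition relax :: "real \<Rightarrow> real^'n \<Rightarrow> real^'n" where
  "relax \<theta> W = W + \<theta> *\<^sub>R (equilibrate W - W)"

text \<open>Closed forms of the half-step state, the numerical flux and the numerical source, in terms of the
cell values on which they depend and of \<open>\<sigma> = dt / dx\<close>. Taking \<open>\<sigma>\<close> instead of \<open>dx\<close> as a parameter
keeps them meaningful at \<open>dt = 0\<close>, where they are differentiated. They use \<open>equilibrate W - W\<close> for
the source and are therefore defined near \<open>K\<close>, not only on it.\<close>

definition half_value :: "real \<Rightarrow> real \<Rightarrow> real \<Rightarrow> real^'n \<Rightarrow> real^'n \<Rightarrow> real^'n" where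
  "half_value \<epsilon> \<sigma> dt a b = relax (implicit_weight \<epsilon> dt)
     ((1 / 2) *\<^sub>R (b + a)
       - (\<sigma> / 2) *\<^sub>R (f (relax (relax_weight \<epsilon> dt) b) - f (relax (relax_weight \<epsilon> dt) a)))"

definition flux_value :: "real \<Rightarrow> real \<Rightarrow> real \<Rightarrow> real^'n \<Rightarrow> real^'n \<Rightarrow> real^'n" where
  "flux_value \<epsilon> \<sigma> dt a b = (1 / 4) *\<^sub>R
     (2 *\<^sub>R f (relax (relax_weight \<epsilon> dt) (half_value \<epsilon> \<sigma> dt a b))
      + f (relax (relax_weight \<epsilon> dt) a) + f (relax (relax_weight \<epsilon> dt) b) - (1 / \<sigma>) *\<^sub>R (b - a))"

definition source_value :: "real \<Rightarrow> real \<Rightarrow> real \<Rightarrow> real^'n \<Rightarrow> real^'n \<Rightarrow> real^'n \<Rightarrow> real^'n" where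
  "source_value \<epsilon> \<sigma> dt a b c =
     (let h = half_value \<epsilon> \<sigma> dt; S = \<lambda>W. equilibrate W - W
      in (1 / (4 * \<epsilon>)) *\<^sub>R (2 *\<^sub>R S (h (h a b) (h b c)) + S (h a b) + S (h b c)))"

lemma state_of_components:
  "M1 *v state_of M1 M2 u v = u" "M2 *v state_of M1 M2 u v = v"
  using surj_f_inv_f[OF bij_is_surj[OF nonsingular], of "(u, v)"] by (simp_all add: state_of_def)

lemma components_eqI: "M1 *v W = M1 *v W' \<Longrightarrow> M2 *v W = M2 *v W' \<Longrightarrow> W = W'"
  using injD[OF bij_is_inj[OF nonsingular], of W W'] by simp

lemma M1_equilibrate [simp]: "M1 *v equilibrate W = M1 *v W"
  by (simp add: equilibrate_def equilibrium_def state_of_components)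

lemma M2_equilibrate: "M2 *v equilibrate W = Q (M1 *v W)"
  by (simp add: equilibrate_def equilibrium_def state_of_components)

lemma equilibrate_cong: "M1 *v W = M1 *v W' \<Longrightarrow> equilibrate W = equilibrate W'"
  by (simp add: equilibrate_def)

lemma equilibrate_in_K: "W \<in> K \<Longrightarrow> equilibrate W \<in> K"
  unfolding equilibrate_def by (rule equilibrium_in_K) simp

lemma relax_0 [simp]: "relax 0 W = W"
  by (simp add: relax_def)

text \<open>Compare the \<open>M1\<close>- and \<open>M2\<close>-components. This replaces the source, which is specified on \<open>K\<close> alone,
by a map that is differentiable on the whole space.\<close>

lemma source_eq: "W \<in> K \<Longrightarrow> R W = equilibrate W - W"
  by (rule components_eqI)
    (simp_all add: conserved relaxed M2_equilibrate matrix_vector_mult_diff_distrib)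

lemma f_differentiable: "W \<in> K \<Longrightarrow> f differentiable (at W)"
  using smooth_f smooth_on_imp_differentiable by blast

lemma equilibrium_differentiable: "equilibrium M1 M2 Q differentiable (at u)"
proof -
  have "linear (\<lambda>W. (M1 *v W, M2 *v W))"
    by (intro linearI)
      (simp_all add: matrix_vector_right_distrib matrix_vector_mult_scaleR)
  then obtain g where "linear g" and g: "(\<lambda>W. (M1 *v W, M2 *v W)) \<circ> g = id"
    using linear_surjective_right_inverse bij_is_surj[OF nonsingular] by blast
  moreover have "g = inv (\<lambda>W. (M1 *v W, M2 *v W))"
  proof
    fix y
    have "(\<lambda>W. (M1 *v W, M2 *v W)) (g y) = y"
      using fun_cong[OF g, of y] by simp
    then show "g y = inv (\<lambda>W. (M1 *v W, M2 *v W)) y"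
      by (rule inv_f_eq[OF bij_is_inj[OF nonsingular], symmetric])
  qed
  ultimately have "linear (inv (\<lambda>W. (M1 *v W, M2 *v W)))"
    by simp
  then have inv: "inv (\<lambda>W. (M1 *v W, M2 *v W)) differentiable (at (u, Q u))"
    by (rule linear_imp_differentiable)
  have "Q differentiable (at u)"
    using smooth_on_imp_differentiable[OF smooth_Q] by simp
  then have "(\<lambda>u. (u, Q u)) differentiable (at u)"
    by (rule differentiable_Pair[OF differentiable_ident])
  from differentiable_compose[where f = "inv (\<lambda>W. (M1 *v W, M2 *v W))", OF inv this]
  show ?thesis
    by (simp only: equilibrium_def[abs_def] state_of_def)
qed

lemma equilibrate_differentiable: "equilibrate differentiable (at W)"
  unfolding equilibrate_def[abs_def]
  by (rule differentiable_compose[where f = "equilibrium M1 M2 Q", OF equilibrium_differentiable])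
    (simp add: linear_imp_differentiable)

text \<open>Since \<open>M1 w\<close> is conserved, the target \<open>equilibrate (w t)\<close> of the relaxation does not move, and the
nonlinear equation becomes linear; \<open>exp (t / \<epsilon>)\<close> is its integrating factor.\<close>

lemma relaxation_solution_eq:
  assumes w: "relaxation_solution K R \<epsilon> T W0 w" and \<epsilon>: "0 < \<epsilon>" and T: "0 \<le> T"
  shows "w T = relax (1 - exp (- T / \<epsilon>)) W0"
proof -
  have w0: "w 0 = W0"
    and K: "w t \<in> K"
    and deriv: "(w has_vector_derivative (1 / \<epsilon>) *\<^sub>R R (w t)) (at t within {0..T})"
    if "t \<in> {0..T}" for t
    using w that by (auto simp: relaxation_solution_def)
  have M1w: "M1 *v w t = M1 *v W0" if t: "t \<in> {0..T}" for t
  proof -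
    have "((\<lambda>t. M1 *v w t) has_vector_derivative 0) (at t within {0..T})" if "t \<in> {0..T}" for t
      using bounded_linear.has_vector_derivative[OF matrix_vector_mul_bounded_linear[of M1] deriv[OF that]]
      by (simp add: matrix_vector_mult_scaleR conserved K[OF that])
    then have "\<exists>c. \<forall>t\<in>{0..T}. M1 *v w t = c"
      by (intro has_derivative_zero_constant) (simp_all add: has_vector_derivative_def)
    then show ?thesis
      using t T w0[OF t] by (metis atLeastAtMost_iff order_refl)
  qed
  let ?e = "equilibrate W0"
  have "((\<lambda>t. exp (t / \<epsilon>) *\<^sub>R (w t - ?e)) has_vector_derivative 0) (at t within {0..T})"
    if t: "t \<in> {0..T}" for t
  proof -
    have "R (w t) = ?e - w t"
      using source_eq[OF K[OF t]] equilibrate_cong[OF M1w[OF t]] by simp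
    then have d: "(w has_vector_derivative (1 / \<epsilon>) *\<^sub>R (?e - w t)) (at t within {0..T})"
      using deriv[OF t] by simp
    have e: "((\<lambda>t. exp (t / \<epsilon>)) has_real_derivative exp (t / \<epsilon>) / \<epsilon>) (at t within {0..T})"
      using \<epsilon> by (auto intro!: derivative_eq_intros)
    show ?thesis
      using has_vector_derivative_scaleR[OF e has_vector_derivative_diff[OF d has_vector_derivative_const[of ?e]]]
      by (simp flip: scaleR_add_right)
  qed
  then have "\<exists>c. \<forall>t\<in>{0..T}. exp (t / \<epsilon>) *\<^sub>R (w t - ?e) = c"
    by (intro has_derivative_zero_constant) (simp_all add: has_vector_derivative_def)
  then obtain c where c: "\<And>t. t \<in> {0..T} \<Longrightarrow> exp (t / \<epsilon>) *\<^sub>R (w t - ?e) = c"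
    by blast
  have "exp (T / \<epsilon>) *\<^sub>R (w T - ?e) = W0 - ?e"
    using c[of T] c[of 0] w0[of 0] T by simp
  then have "exp (- T / \<epsilon>) *\<^sub>R (exp (T / \<epsilon>) *\<^sub>R (w T - ?e)) = exp (- T / \<epsilon>) *\<^sub>R (W0 - ?e)"
    by simp
  then have "w T - ?e = exp (- T / \<epsilon>) *\<^sub>R (W0 - ?e)"
    by (simp add: exp_minus)
  then show ?thesis
    by (simp add: relax_def diff_eq_eq scaleR_diff_left scaleR_diff_right)
qed

text \<open>The implicit equation is linear for the same reason: \<open>W\<close> and the explicit part \<open>X\<close> share their
conserved components, hence their equilibrium.\<close>

lemma implicit_relaxation_eq:
  assumes W: "W \<in> K" "W = X + (dt / (2 * \<epsilon>)) *\<^sub>R R W" and "0 < \<epsilon>" "0 < dt"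
  shows "W = relax (implicit_weight \<epsilon> dt) X"
proof -
  define a where "a = dt / (2 * \<epsilon>)"
  have a: "0 < a" "implicit_weight \<epsilon> dt = a / (1 + a)"
    using assms by (simp_all add: a_def implicit_weight_def field_simps)
  have "M1 *v W = M1 *v (X + a *\<^sub>R R W)"
    using W(2) by (simp add: a_def)
  then have "M1 *v W = M1 *v X"
    by (simp add: matrix_vector_right_distrib matrix_vector_mult_scaleR conserved[OF W(1)])
  then have "equilibrate W = equilibrate X"
    by (rule equilibrate_cong)
  then have "W = X + a *\<^sub>R (equilibrate X - W)"
    using W(2) source_eq[OF W(1)] by (simp add: a_def)
  then have "(1 + a) *\<^sub>R W = X + a *\<^sub>R equilibrate X"
    by (simp add: algebra_simps)
  also have "\<dots> = (1 + a) *\<^sub>R relax (a / (1 + a)) X"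
    using a(1) by (simp add: relax_def scaleR_add_right) (simp add: scaleR_add_left scaleR_diff_right)
  finally show ?thesis
    using a by simp
qed

lemma half_step_values:
  assumes step: "half_step K f R \<epsilon> dt dx Wl Wr wL wR W" and pos: "0 < \<epsilon>" "0 < dt"
  shows "wL (dt / 2) = relax (relax_weight \<epsilon> dt) Wl"
    and "wR (dt / 2) = relax (relax_weight \<epsilon> dt) Wr"
    and "W = half_value \<epsilon> (dt / dx) dt Wl Wr"
proof -
  show L: "wL (dt / 2) = relax (relax_weight \<epsilon> dt) Wl"
    using step pos relaxation_solution_eq[of \<epsilon> "dt / 2" Wl wL]
    by (simp add: half_step_def relax_weight_def)
  show R: "wR (dt / 2) = relax (relax_weight \<epsilon> dt) Wr"
    using step pos relaxation_solution_eq[of \<epsilon> "dt / 2" Wr wR]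
    by (simp add: half_step_def relax_weight_def)
  show "W = half_value \<epsilon> (dt / dx) dt Wl Wr"
    unfolding half_value_def
    by (rule implicit_relaxation_eq)
      (use step pos L R in \<open>simp_all add: half_step_def mult.commute\<close>)
qed

lemma staggered_step_values:
  assumes step: "staggered_step K f R \<epsilon> dt dx r" and pos: "0 < \<epsilon>" "0 < dt"
  defines "\<sigma> \<equiv> dt / dx"
  shows "half r j = half_value \<epsilon> \<sigma> dt (cells r j) (cells r (j + 1))"
    and "new r j = half_value \<epsilon> \<sigma> dt (half r (j - 1)) (half r j)"
    and "staggered_flux f dt dx r j = flux_value \<epsilon> \<sigma> dt (cells r j) (cells r (j + 1))"
    and "staggered_source R \<epsilon> r j
      = source_value \<epsilon> \<sigma> dt (cells r (j - 1)) (cells r j) (cells r (j + 1))"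
proof -
  have s1: "half_step K f R \<epsilon> dt dx (cells r j) (cells r (j + 1))
      (relax1L r j) (relax1R r j) (half r j)"
    and s2: "half_step K f R \<epsilon> dt dx (half r (j - 1)) (half r j)
      (relax2L r j) (relax2R r j) (new r j)" for j
    using step by (simp_all add: staggered_step_def)
  show half: "half r j = half_value \<epsilon> \<sigma> dt (cells r j) (cells r (j + 1))" for j
    unfolding \<sigma>_def by (rule half_step_values(3)[OF s1 pos])
  show new: "new r j = half_value \<epsilon> \<sigma> dt (half r (j - 1)) (half r j)"
    unfolding \<sigma>_def by (rule half_step_values(3)[OF s2 pos])
  show "staggered_flux f dt dx r j = flux_value \<epsilon> \<sigma> dt (cells r j) (cells r (j + 1))"
    using half_step_values(2)[OF s1 pos, of j] half_step_values(2)[OF s1 pos, of "j - 1"]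
      half_step_values(2)[OF s2 pos, of j]
    unfolding staggered_flux_def flux_value_def half[of j, symmetric] by (simp add: \<sigma>_def)
  have "new r j \<in> K" "half r j \<in> K" "half r (j - 1) \<in> K"
    using s1 s2 by (auto simp: half_step_def)
  then show "staggered_source R \<epsilon> r j
      = source_value \<epsilon> \<sigma> dt (cells r (j - 1)) (cells r j) (cells r (j + 1))"
    unfolding source_value_def Let_def staggered_source_def
    by (simp add: source_eq half[of j, symmetric] half[of "j - 1", simplified, symmetric] new[symmetric])
qed

text \<open>The relaxed states to the left of one node and to the right of the previous one start from the same
value, so the closed form of the relaxation makes them equal, and the flux differences telescope.\<close>

lemma conservative_form_holds:
  assumes \<epsilon>: "0 < \<epsilon>"
  shows "conservative_form K f R \<epsilon>"
  unfolding conservative_form_def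
proof (intro allI impI, elim conjE)
  fix dt dx :: real and r :: "'n run" and j
  assume dt: "0 < dt" and dx: "0 < dx" and step: "staggered_step K f R \<epsilon> dt dx r"
  have s1: "half_step K f R \<epsilon> dt dx (cells r j) (cells r (j + 1))
      (relax1L r j) (relax1R r j) (half r j)"
    and s2: "half_step K f R \<epsilon> dt dx (half r (j - 1)) (half r j)
      (relax2L r j) (relax2R r j) (new r j)" for j
    using step by (simp_all add: staggered_step_def)
  have cont: "relax1L r i (dt / 2) = relax1R r (i - 1) (dt / 2)"
    "relax2L r i (dt / 2) = relax2R r (i - 1) (dt / 2)" for i
    using half_step_values(1)[OF s1 \<epsilon> dt, of i] half_step_values(2)[OF s1 \<epsilon> dt, of "i - 1"]
      half_step_values(1)[OF s2 \<epsilon> dt, of i] half_step_values(2)[OF s2 \<epsilon> dt, of "i - 1"]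
    by simp_all
  let ?f = "\<lambda>i. f (relax1R r i (dt / 2))"
  have half: "half r i = (1 / 2) *\<^sub>R (cells r (i + 1) + cells r i)
      - (dt / (2 * dx)) *\<^sub>R (?f i - ?f (i - 1)) + (dt / (2 * \<epsilon>)) *\<^sub>R R (half r i)" for i
    using s1[of i] cont(1)[of i] by (simp add: half_step_def)
  have "new r j = (1 / 2) *\<^sub>R (half r j + half r (j - 1))
      - (dt / (2 * dx)) *\<^sub>R (f (relax2R r j (dt / 2)) - f (relax2R r (j - 1) (dt / 2)))
      + (dt / (2 * \<epsilon>)) *\<^sub>R R (new r j)"
    using s2[of j] cont(2)[of j] by (simp add: half_step_def)
  also have "half r j + half r (j - 1) =
      (1 / 2) *\<^sub>R (cells r (j + 1) + cells r j) - (dt / (2 * dx)) *\<^sub>R (?f j - ?f (j - 1))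
      + (dt / (2 * \<epsilon>)) *\<^sub>R R (half r j)
      + ((1 / 2) *\<^sub>R (cells r j + cells r (j - 1)) - (dt / (2 * dx)) *\<^sub>R (?f (j - 1) - ?f (j - 2))
      + (dt / (2 * \<epsilon>)) *\<^sub>R R (half r (j - 1)))"
    using half[of j] half[of "j - 1"] by simp
  also note conservative_rearrangement[OF dt dx \<epsilon>]
  finally show "new r j = cells r j
      - (dt / dx) *\<^sub>R (staggered_flux f dt dx r j - staggered_flux f dt dx r (j - 1))
      + dt *\<^sub>R staggered_source R \<epsilon> r j"
    by (simp only: staggered_flux_def staggered_source_def diff_add_cancel diff_diff_eq one_add_one)
qed

section \<open>Consistency for a fixed relaxation time\<close>

lemma relax_differentiable:
  fixes X :: "'p::real_normed_vector \<Rightarrow> real^'n"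
  assumes "\<theta> differentiable (at p)" "X differentiable (at p)"
  shows "(\<lambda>q. relax (\<theta> q) (X q)) differentiable (at p)"
  unfolding relax_def
  by (intro differentiable_add differentiable_scaleR differentiable_diff assms
      differentiable_compose[OF equilibrate_differentiable])

lemma f_relax_differentiable:
  fixes X :: "'p::real_normed_vector \<Rightarrow> real^'n"
  assumes t: "t differentiable (at p)" "t p = 0"
    and X: "X differentiable (at p)" "X p \<in> K"
  shows "(\<lambda>q. f (relax (relax_weight \<epsilon> (t q)) (X q))) differentiable (at p)"
  by (rule differentiable_compose[where f = f])
    (simp_all add: t X f_differentiable relax_differentiable differentiable_relax_weight)

lemma half_value_diagonal [simp]: "half_value \<epsilon> \<sigma> 0 a a = a"
  by (simp add: half_value_def flip: scaleR_2)

text \<open>On equal states and at \<open>dt = 0\<close> nothing relaxes and all fluxes in the average coincide. That this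
holds for every \<open>a\<close>, not only at one state, is what determines the derivative of the numerical flux in
the direction \<open>(v, v, 0)\<close> and thereby the limit of the flux difference.\<close>

lemma flux_value_diagonal: "flux_value \<epsilon> \<sigma> 0 a a = f a"
  by (simp add: flux_value_def vec_eq_iff)

lemma source_value_diagonal:
  "\<epsilon> \<noteq> 0 \<Longrightarrow> source_value \<epsilon> \<sigma> 0 a a a = (1 / \<epsilon>) *\<^sub>R (equilibrate a - a)"
  by (simp add: source_value_def vec_eq_iff field_simps)

lemma half_value_differentiable:
  fixes A B :: "'p::real_normed_vector \<Rightarrow> real^'n"
  assumes t: "t differentiable (at p)" "t p = 0" and \<epsilon>: "\<epsilon> \<noteq> 0"
    and A: "A differentiable (at p)" "A p \<in> K" and B: "B differentiable (at p)" "B p \<in> K"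
  shows "(\<lambda>q. half_value \<epsilon> \<sigma> (t q) (A q) (B q)) differentiable (at p)"
  unfolding half_value_def
  by (intro relax_differentiable differentiable_implicit_weight differentiable_diff
      differentiable_add differentiable_scaleR differentiable_const f_relax_differentiable assms)
    (simp add: t \<epsilon>)

lemma flux_value_differentiable:
  fixes A B :: "'p::real_normed_vector \<Rightarrow> real^'n"
  assumes t: "t differentiable (at p)" "t p = 0" and \<epsilon>: "\<epsilon> \<noteq> 0"
    and A: "A differentiable (at p)" "A p = W" and B: "B differentiable (at p)" "B p = W"
    and W: "W \<in> K"
  shows "(\<lambda>q. flux_value \<epsilon> \<sigma> (t q) (A q) (B q)) differentiable (at p)"
  unfolding flux_value_def
  by (intro differentiable_diff differentiable_add differentiable_scaleR differentiable_const
      f_relax_differentiable half_value_differentiable assms)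
    (simp_all add: t A B W)

lemma source_value_differentiable:
  fixes A B C :: "'p::real_normed_vector \<Rightarrow> real^'n"
  assumes t: "t differentiable (at p)" "t p = 0" and \<epsilon>: "\<epsilon> \<noteq> 0"
    and A: "A differentiable (at p)" "A p = W" and B: "B differentiable (at p)" "B p = W"
    and C: "C differentiable (at p)" "C p = W" and W: "W \<in> K"
  shows "(\<lambda>q. source_value \<epsilon> \<sigma> (t q) (A q) (B q) (C q)) differentiable (at p)"
proof -
  let ?h = "half_value \<epsilon> \<sigma>"
  have S: "(\<lambda>q. equilibrate (X q) - X q) differentiable (at p)"
    if "X differentiable (at p)" for X :: "'p \<Rightarrow> real^'n"
    by (intro differentiable_diff differentiable_compose[OF equilibrate_differentiable] that)
  have AB: "(\<lambda>q. ?h (t q) (A q) (B q)) differentiable (at p)"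
    and BC: "(\<lambda>q. ?h (t q) (B q) (C q)) differentiable (at p)"
    by (intro half_value_differentiable assms; simp add: A B C W)+
  have ABC: "(\<lambda>q. ?h (t q) (?h (t q) (A q) (B q)) (?h (t q) (B q) (C q))) differentiable (at p)"
    by (intro half_value_differentiable AB BC t \<epsilon>) (simp_all add: A B C W t)
  show ?thesis
    unfolding source_value_def Let_def
    by (intro differentiable_add differentiable_scaleR differentiable_const S AB BC ABC)
qed

lemma flux_value_differentiable_at_diagonal:
  assumes "\<epsilon> \<noteq> 0" "W \<in> K"
  shows "(\<lambda>(a, b, dt). flux_value \<epsilon> \<sigma> dt a b) differentiable (at (W, W, 0))"
  unfolding case_prod_beta
  by (rule flux_value_differentiable[where W = W])
    (auto intro!: bounded_linear_imp_differentiable bounded_linear_intros assms)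

lemma source_value_differentiable_at_diagonal:
  assumes "\<epsilon> \<noteq> 0" "W \<in> K"
  shows "(\<lambda>(a, b, c, dt). source_value \<epsilon> \<sigma> dt a b c) differentiable (at (W, W, W, 0))"
  unfolding case_prod_beta
  by (rule source_value_differentiable[where W = W])
    (auto intro!: bounded_linear_imp_differentiable bounded_linear_intros assms)

lemma flux_consistent_holds:
  assumes \<epsilon>: "0 < \<epsilon>"
  shows "flux_consistent K f R \<epsilon>"
  unfolding flux_consistent_def
proof (intro ballI allI impI)
  fix W and \<sigma> :: real
  assume W: "W \<in> K" and \<sigma>: "0 < \<sigma>"
  let ?g = "\<lambda>(a, b, dt). flux_value \<epsilon> \<sigma> dt a b"
  have "?g differentiable (at (W, W, 0))"
    using flux_value_differentiable_at_diagonal W \<epsilon> by simp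
  then obtain d L where d: "0 < d" "0 \<le> L"
    "\<And>q. norm (q - (W, W, 0)) < d \<Longrightarrow> norm (?g q - ?g (W, W, 0)) \<le> L * norm (q - (W, W, 0))"
    by (rule differentiable_imp_locally_linear_bound) blast
  have "norm (staggered_flux f dt dx r j - f W)
      \<le> L * (norm (cells r j - W) + norm (cells r (j + 1) - W) + dt)"
    if h: "0 < dx" "dt = \<sigma> * dx" "dt < d / 3" "staggered_step K f R \<epsilon> dt dx r"
      "norm (cells r j - W) < d / 3" "norm (cells r (j + 1) - W) < d / 3" for dt dx r j
  proof -
    have dt: "0 < dt" "dt / dx = \<sigma>"
      using h \<sigma> by simp_all
    let ?q = "(cells r j, cells r (j + 1), dt)"
    have "norm (?q - (W, W, 0)) \<le> norm (cells r j - W) + norm (cells r (j + 1) - W, dt)"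
      using norm_Pair_le[of "cells r j - W" "(cells r (j + 1) - W, dt)"] by simp
    then have le: "norm (?q - (W, W, 0)) \<le> norm (cells r j - W) + norm (cells r (j + 1) - W) + dt"
      using norm_Pair_le[of "cells r (j + 1) - W" dt] dt by simp
    then have "norm (?g ?q - ?g (W, W, 0)) \<le> L * norm (?q - (W, W, 0))"
      using h by (intro d(3)) simp
    also have "\<dots> \<le> L * (norm (cells r j - W) + norm (cells r (j + 1) - W) + dt)"
      by (rule mult_left_mono[OF le d(2)])
    finally show ?thesis
      using staggered_step_values(3)[OF h(4) \<epsilon> dt(1), of j]
      by (simp add: dt(2) flux_value_diagonal)
  qed
  then show "\<exists>L. \<exists>\<delta>>0. \<forall>dt dx r j. 0 < dx \<and> dt = \<sigma> * dx \<and> dt < \<delta> \<and>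
      staggered_step K f R \<epsilon> dt dx r \<and> norm (cells r j - W) < \<delta> \<and> norm (cells r (j + 1) - W) < \<delta> \<longrightarrow>
      norm (staggered_flux f dt dx r j - f W)
        \<le> L * (norm (cells r j - W) + norm (cells r (j + 1) - W) + dt)"
    using d(1) by (intro exI[of _ L] exI[of _ "d / 3"]) auto
qed

lemma source_consistent_holds:
  assumes \<epsilon>: "0 < \<epsilon>"
  shows "source_consistent K f R \<epsilon>"
  unfolding source_consistent_def
proof (intro ballI allI impI)
  fix W and \<sigma> :: real
  assume W: "W \<in> K" and \<sigma>: "0 < \<sigma>"
  let ?g = "\<lambda>(a, b, c, dt). source_value \<epsilon> \<sigma> dt a b c"
  have "?g differentiable (at (W, W, W, 0))"
    using source_value_differentiable_at_diagonal W \<epsilon> by simp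
  then obtain d L where d: "0 < d" "0 \<le> L"
    "\<And>q. norm (q - (W, W, W, 0)) < d \<Longrightarrow>
      norm (?g q - ?g (W, W, W, 0)) \<le> L * norm (q - (W, W, W, 0))"
    by (rule differentiable_imp_locally_linear_bound) blast
  have "norm (staggered_source R \<epsilon> r j - (1 / \<epsilon>) *\<^sub>R R W)
      \<le> L * ((\<Sum>i=j - 1..j + 1. norm (cells r i - W)) + dt)"
    if h: "0 < dx" "dt = \<sigma> * dx" "dt < d / 4" "staggered_step K f R \<epsilon> dt dx r"
      "\<forall>i\<in>{j - 1..j + 1}. norm (cells r i - W) < d / 4" for dt dx r j
  proof -
    have dt: "0 < dt" "dt / dx = \<sigma>"
      using h \<sigma> by simp_all
    have stencil: "{j - 1..j + 1} = {j - 1, j, j + 1}"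
      by auto
    let ?a = "cells r (j - 1)" and ?b = "cells r j" and ?c = "cells r (j + 1)"
    let ?q = "(?a, ?b, ?c, dt)"
    have sum: "(\<Sum>i=j - 1..j + 1. norm (cells r i - W)) = norm (?a - W) + norm (?b - W) + norm (?c - W)"
      unfolding stencil by simp
    have le: "norm (?q - (W, W, W, 0)) \<le> norm (?a - W) + norm (?b - W) + norm (?c - W) + dt"
      using norm_Pair_le[of "?a - W" "(?b - W, ?c - W, dt)"]
        norm_Pair_le[of "?b - W" "(?c - W, dt)"] norm_Pair_le[of "?c - W" dt] dt by simp
    moreover have "norm (?a - W) < d / 4" "norm (?b - W) < d / 4" "norm (?c - W) < d / 4"
      using h(5) by simp_all
    ultimately have "norm (?g ?q - ?g (W, W, W, 0)) \<le> L * norm (?q - (W, W, W, 0))"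
      using h(3) by (intro d(3)) linarith
    also have "\<dots> \<le> L * (norm (?a - W) + norm (?b - W) + norm (?c - W) + dt)"
      by (rule mult_left_mono[OF le d(2)])
    finally show ?thesis
      using staggered_step_values(4)[OF h(4) \<epsilon> dt(1), of j] \<epsilon>
      by (simp add: dt(2) source_value_diagonal source_eq[OF W] sum)
  qed
  then show "\<exists>L. \<exists>\<delta>>0. \<forall>dt dx r j. 0 < dx \<and> dt = \<sigma> * dx \<and> dt < \<delta> \<and>
      staggered_step K f R \<epsilon> dt dx r \<and> (\<forall>i\<in>{j - 1..j + 1}. norm (cells r i - W) < \<delta>) \<longrightarrow>
      norm (staggered_source R \<epsilon> r j - (1 / \<epsilon>) *\<^sub>R R W)
        \<le> L * ((\<Sum>i=j - 1..j + 1. norm (cells r i - W)) + dt)"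
    using d(1) by (intro exI[of _ L] exI[of _ "d / 4"]) auto
qed

text \<open>The local truncation error in closed form: time increment, flux difference and source, each of which
converges. The time increment tends to \<open>\<partial>\<^sub>t w\<close>, the source to \<open>R w / \<epsilon>\<close>, and the flux difference to
\<open>\<partial>\<^sub>x f(w) = R w / \<epsilon> - \<partial>\<^sub>t w\<close>; the differential equation makes the sum vanish.\<close>

lemma truncation_error_limit:
  fixes w :: "real \<Rightarrow> real \<Rightarrow> real^'n" and t x :: real
  assumes \<epsilon>: "0 < \<epsilon>" and \<sigma>: "0 < \<sigma>" and t: "0 \<le> t" "t < T"
    and sol: "classical_solution K f R \<epsilon> T w"
  defines "c k h \<equiv> cell_average (w t) (x + k * h) h"
  shows "((\<lambda>h. - ((1 / (\<sigma> * h)) *\<^sub>R (cell_average (w (t + \<sigma> * h)) x h - c 0 h))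
      - (1 / h) *\<^sub>R (flux_value \<epsilon> \<sigma> (\<sigma> * h) (c 0 h) (c 1 h)
                    - flux_value \<epsilon> \<sigma> (\<sigma> * h) (c (- 1) h) (c 0 h))
      + source_value \<epsilon> \<sigma> (\<sigma> * h) (c (- 1) h) (c 0 h) (c 1 h)) \<longlongrightarrow> 0) (at_right 0)"
proof -
  obtain wt wx where wt_cont: "continuous_on ({0..T} \<times> UNIV) (\<lambda>(s, y). wt s y)"
    and K: "\<And>s y. s \<in> {0..T} \<Longrightarrow> w s y \<in> K"
    and wt: "\<And>s y. s \<in> {0..T} \<Longrightarrow> ((\<lambda>s. w s y) has_vector_derivative wt s y) (at s within {0..T})"
    and wx: "\<And>s y. s \<in> {0..T} \<Longrightarrow> ((\<lambda>y. w s y) has_vector_derivative wx s y) (at y)"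
    and pde: "\<And>s y. s \<in> {0..T} \<Longrightarrow>
      ((\<lambda>y. f (w s y)) has_vector_derivative ((1 / \<epsilon>) *\<^sub>R R (w s y) - wt s y)) (at y)"
    using sol unfolding classical_solution_def by blast
  have tT: "t \<in> {0..T}"
    using t by simp
  define W v where "W = w t x" and "v = wx t x"
  have W: "W \<in> K"
    using K[OF tT] by (simp add: W_def)
  have cont: "continuous_on UNIV (w s)" if "s \<in> {0..T}" for s
    using wx[OF that] by (intro continuous_at_imp_continuous_on ballI)
      (metis has_vector_derivative_continuous)
  have quot: "((\<lambda>h. (1 / h) *\<^sub>R (c k h - W)) \<longlongrightarrow> k *\<^sub>R v) (at_right 0)" for k
    unfolding c_def W_def v_def
    by (rule cell_average_first_order[OF cont[OF tT] wx[OF tT]])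
  have c_lim: "(c k \<longlongrightarrow> W) (at_right 0)" for k
    using tendsto_of_right_quotient[OF quot] by simp
  have time_quot: "((\<lambda>h. (1 / h) *\<^sub>R (\<sigma> * h - 0)) \<longlongrightarrow> \<sigma>) (at_right 0)"
  proof (rule Lim_transform_eventually[OF tendsto_const])
    show "\<forall>\<^sub>F h in at_right 0. \<sigma> = (1 / h) *\<^sub>R (\<sigma> * h - 0)"
      using eventually_at_right_less[of 0] by eventually_elim simp
  qed
  let ?g = "\<lambda>(a, b, dt). flux_value \<epsilon> \<sigma> dt a b"
  obtain G where G: "(?g has_derivative G) (at (W, W, 0))"
    using flux_value_differentiable_at_diagonal[of \<epsilon> W \<sigma>] \<epsilon> W unfolding differentiable_def by auto
  have F: "((\<lambda>h. (1 / h) *\<^sub>R (flux_value \<epsilon> \<sigma> (\<sigma> * h) (c k h) (c l h) - f W))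
      \<longlongrightarrow> G (k *\<^sub>R v, l *\<^sub>R v, \<sigma>)) (at_right 0)" for k l
  proof -
    have "((\<lambda>h. (1 / h) *\<^sub>R ((c k h, c l h, \<sigma> * h) - (W, W, 0)))
        \<longlongrightarrow> (k *\<^sub>R v, l *\<^sub>R v, \<sigma>)) (at_right 0)"
      using tendsto_Pair[OF quot tendsto_Pair[OF quot time_quot]] by simp
    from has_derivative_right_quotient[OF G this] show ?thesis
      by (simp add: flux_value_diagonal)
  qed
  have "((\<lambda>h. (1 / h) *\<^sub>R (flux_value \<epsilon> \<sigma> (\<sigma> * h) (c 0 h) (c 1 h) - f W)
      - (1 / h) *\<^sub>R (flux_value \<epsilon> \<sigma> (\<sigma> * h) (c (- 1) h) (c 0 h) - f W))
      \<longlongrightarrow> G (0 *\<^sub>R v, 1 *\<^sub>R v, \<sigma>) - G (- 1 *\<^sub>R v, 0 *\<^sub>R v, \<sigma>)) (at_right 0)"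
    by (intro tendsto_diff F)
  moreover have "G (0 *\<^sub>R v, 1 *\<^sub>R v, \<sigma>) - G (- 1 *\<^sub>R v, 0 *\<^sub>R v, \<sigma>) = G (v, v, 0)"
    using linear_diff[OF has_derivative_linear[OF G], of "(0, v, \<sigma>)" "(- v, 0, \<sigma>)"] by simp
  \<comment> \<open>Differentiate \<open>flux_value \<epsilon> \<sigma> 0 a a = f a\<close> along \<open>a = w t y\<close>.\<close>
  moreover have "G (v, v, 0) = (1 / \<epsilon>) *\<^sub>R R W - wt t x"
  proof -
    have w_deriv: "(w t has_derivative (\<lambda>h. h *\<^sub>R v)) (at x)"
      using wx[OF tT, of x] by (simp add: has_vector_derivative_def v_def)
    have "((\<lambda>y. (w t y, w t y, 0::real)) has_derivative (\<lambda>h. (h *\<^sub>R v, h *\<^sub>R v, 0))) (at x)"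
      by (intro has_derivative_Pair w_deriv has_derivative_const)
    from has_derivative_compose[OF this, of ?g G] G
    have "((\<lambda>y. f (w t y)) has_derivative (\<lambda>h. G (h *\<^sub>R v, h *\<^sub>R v, 0))) (at x)"
      by (simp add: flux_value_diagonal W_def)
    moreover have "G (h *\<^sub>R v, h *\<^sub>R v, 0) = h *\<^sub>R G (v, v, 0)" for h
      using linear_cmul[OF has_derivative_linear[OF G], of h "(v, v, 0)"] by simp
    ultimately have "((\<lambda>y. f (w t y)) has_vector_derivative G (v, v, 0)) (at x)"
      by (simp add: has_vector_derivative_def)
    then show ?thesis
      using pde[OF tT, of x] unfolding W_def by (rule vector_derivative_unique_at)
  qed
  ultimately have flux: "((\<lambda>h. (1 / h) *\<^sub>R (flux_value \<epsilon> \<sigma> (\<sigma> * h) (c 0 h) (c 1 h)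
      - flux_value \<epsilon> \<sigma> (\<sigma> * h) (c (- 1) h) (c 0 h))) \<longlongrightarrow> (1 / \<epsilon>) *\<^sub>R R W - wt t x) (at_right 0)"
    by (simp flip: scaleR_diff_right)
  have time: "((\<lambda>h. (1 / (\<sigma> * h)) *\<^sub>R (cell_average (w (t + \<sigma> * h)) x h - c 0 h)) \<longlongrightarrow> wt t x)
      (at_right 0)"
    using cell_average_time_increment[OF wt_cont wt cont t \<sigma>] by (simp add: c_def)
  let ?s = "\<lambda>(a, b, c, dt). source_value \<epsilon> \<sigma> dt a b c"
  have s_cont: "isCont ?s (W, W, W, 0)"
    using source_value_differentiable_at_diagonal[of \<epsilon> W \<sigma>] \<epsilon> W
    by (intro differentiable_imp_continuous_within) simp
  have "((\<lambda>h. \<sigma> * h) \<longlongrightarrow> \<sigma> * 0) (at_right 0)"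
    by (intro tendsto_intros)
  then have "((\<lambda>h. (c (- 1) h, c 0 h, c 1 h, \<sigma> * h)) \<longlongrightarrow> (W, W, W, 0)) (at_right 0)"
    by (intro tendsto_Pair c_lim) simp
  from isCont_tendsto_compose[OF s_cont this]
  have source: "((\<lambda>h. source_value \<epsilon> \<sigma> (\<sigma> * h) (c (- 1) h) (c 0 h) (c 1 h))
      \<longlongrightarrow> (1 / \<epsilon>) *\<^sub>R R W) (at_right 0)"
    using \<epsilon> by (simp add: source_value_diagonal source_eq[OF W])
  have "- wt t x - ((1 / \<epsilon>) *\<^sub>R R W - wt t x) + (1 / \<epsilon>) *\<^sub>R R W = 0"
    by simp
  with tendsto_add[OF tendsto_diff[OF tendsto_minus[OF time] flux] source] show ?thesis
    by simp
qed

lemma truncation_consistent_holds: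
  assumes \<epsilon>: "0 < \<epsilon>"
  shows "truncation_consistent K f R \<epsilon>"
  unfolding truncation_consistent_def
proof (intro allI impI, elim conjE)
  fix T t x \<sigma> \<eta> :: real and w :: "real \<Rightarrow> real \<Rightarrow> real^'n"
  assume sol: "classical_solution K f R \<epsilon> T w" and t: "0 \<le> t" "t < T"
    and \<sigma>: "0 < \<sigma>" and \<eta>: "0 < \<eta>"
  define c where "c k h = cell_average (w t) (x + k * h) h" for k h
  define E where "E h = - ((1 / (\<sigma> * h)) *\<^sub>R (cell_average (w (t + \<sigma> * h)) x h - c 0 h))
      - (1 / h) *\<^sub>R (flux_value \<epsilon> \<sigma> (\<sigma> * h) (c 0 h) (c 1 h)
                    - flux_value \<epsilon> \<sigma> (\<sigma> * h) (c (- 1) h) (c 0 h))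
      + source_value \<epsilon> \<sigma> (\<sigma> * h) (c (- 1) h) (c 0 h) (c 1 h)" for h
  have "(E \<longlongrightarrow> 0) (at_right 0)"
    unfolding E_def c_def by (rule truncation_error_limit[OF \<epsilon> \<sigma> t sol])
  then have "\<forall>\<^sub>F h in at_right 0. norm (E h) < \<eta>"
    using \<eta> by (auto dest: tendstoD)
  then obtain h0 where h0: "0 < h0" "\<And>h. 0 < h \<Longrightarrow> h < h0 \<Longrightarrow> norm (E h) < \<eta>"
    unfolding eventually_at_right_field by auto
  have "norm ((1 / dt) *\<^sub>R (new r 0 - cell_average (w (t + dt)) x dx)) \<le> \<eta>"
    if h: "0 < dx" "dt = \<sigma> * dx" "dt < \<sigma> * h0" "staggered_step K f R \<epsilon> dt dx r"
      and cells: "\<forall>j. cells r j = cell_average (w t) (x + of_int j * dx) dx" for dt dx r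
  proof -
    have dt: "0 < dt" "dt / dx = \<sigma>"
      using h \<sigma> by simp_all
    have cs: "cells r (- 1) = c (- 1) dx" "cells r 0 = c 0 dx" "cells r 1 = c 1 dx"
      using cells by (simp_all add: c_def)
    let ?F0 = "flux_value \<epsilon> \<sigma> dt (c 0 dx) (c 1 dx)"
      and ?F1 = "flux_value \<epsilon> \<sigma> dt (c (- 1) dx) (c 0 dx)"
      and ?S = "source_value \<epsilon> \<sigma> dt (c (- 1) dx) (c 0 dx) (c 1 dx)"
    have "new r 0 = cells r 0
        - (dt / dx) *\<^sub>R (staggered_flux f dt dx r 0 - staggered_flux f dt dx r (0 - 1))
        + dt *\<^sub>R staggered_source R \<epsilon> r 0"
      using conservative_form_holds[OF \<epsilon>] dt(1) h unfolding conservative_form_def by blast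
    also have "\<dots> = c 0 dx - (dt / dx) *\<^sub>R (?F0 - ?F1) + dt *\<^sub>R ?S"
      using staggered_step_values(3)[OF h(4) \<epsilon> dt(1), of 0]
        staggered_step_values(3)[OF h(4) \<epsilon> dt(1), of "- 1"]
        staggered_step_values(4)[OF h(4) \<epsilon> dt(1), of 0]
      by (simp add: cs dt(2))
    finally have new: "new r 0 = c 0 dx - (dt / dx) *\<^sub>R (?F0 - ?F1) + dt *\<^sub>R ?S" .
    have "(1 / dt) *\<^sub>R (new r 0 - cell_average (w (t + dt)) x dx)
        = - ((1 / dt) *\<^sub>R (cell_average (w (t + dt)) x dx - c 0 dx))
          - (1 / dt) *\<^sub>R (dt / dx) *\<^sub>R (?F0 - ?F1) + (1 / dt) *\<^sub>R dt *\<^sub>R ?S"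
      unfolding new by (simp only: scaleR_diff_right scaleR_add_right) simp
    also have "\<dots> = E dx"
      using dt(1) unfolding E_def h(2)[symmetric] by simp
    finally show ?thesis
      using h0(2)[of dx] h \<sigma> by simp
  qed
  then show "\<exists>\<delta>>0. \<forall>dt dx r. 0 < dx \<and> dt = \<sigma> * dx \<and> dt < \<delta> \<and> staggered_step K f R \<epsilon> dt dx r \<and>
      (\<forall>j. cells r j = cell_average (w t) (x + of_int j * dx) dx) \<longrightarrow>
      norm ((1 / dt) *\<^sub>R (new r 0 - cell_average (w (t + dt)) x dx)) \<le> \<eta>"
    using h0(1) \<sigma> by (intro exI[of _ "\<sigma> * h0"]) auto
qed

theorem finite_volume_consistent_holds:
  assumes "0 < \<epsilon>"
  shows "finite_volume_consistent K f R \<epsilon>"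
  unfolding finite_volume_consistent_def
  using assms conservative_form_holds flux_consistent_holds source_consistent_holds
    truncation_consistent_holds by blast

section \<open>The stiff limit\<close>

lemma relax_tendsto:
  assumes "(\<theta> \<longlongrightarrow> 1) F" "(X \<longlongrightarrow> a) F"
  shows "((\<lambda>e. relax (\<theta> e) (X e)) \<longlongrightarrow> equilibrate a) F"
proof -
  have "isCont equilibrate a"
    using equilibrate_differentiable by (rule differentiable_imp_continuous_within)
  then have "((\<lambda>e. equilibrate (X e)) \<longlongrightarrow> equilibrate a) F"
    using assms(2) by (rule isCont_tendsto_compose)
  then have "((\<lambda>e. X e + \<theta> e *\<^sub>R (equilibrate (X e) - X e)) \<longlongrightarrow> a + 1 *\<^sub>R (equilibrate a - a)) F"
    by (intro tendsto_intros assms)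
  then show ?thesis
    by (simp add: relax_def)
qed

lemma f_tendsto: "(X \<longlongrightarrow> a) F \<Longrightarrow> a \<in> K \<Longrightarrow> ((\<lambda>e. f (X e)) \<longlongrightarrow> f a) F"
  by (rule isCont_tendsto_compose[OF differentiable_imp_continuous_within[OF f_differentiable]])

lemma M1_tendsto: "(X \<longlongrightarrow> a) F \<Longrightarrow> ((\<lambda>e. M1 *v X e) \<longlongrightarrow> M1 *v a) F"
  by (rule bounded_linear.tendsto[OF matrix_vector_mul_bounded_linear])

lemma equilibrium_flux_M1: "equilibrium_flux f M1 M2 Q (M1 *v W) = M1 *v f (equilibrate W)"
  by (simp add: equilibrium_flux_def equilibrate_def)

text \<open>After full relaxation the fluxes in the half-step are taken at equilibrium states, so its conserved
part is the Richtmyer predictor, and the implicit source then projects onto equilibrium.\<close>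

lemma half_value_stiff_limit:
  assumes dt: "0 < dt" and a: "a \<in> K" and b: "b \<in> K"
  shows "((\<lambda>\<epsilon>. half_value \<epsilon> (dt / dx) dt a b) \<longlongrightarrow> equilibrium M1 M2 Q
      (richtmyer_state (equilibrium_flux f M1 M2 Q) dt dx (M1 *v a) (M1 *v b))) (at_right 0)"
proof -
  define X where "X = (1 / 2) *\<^sub>R (b + a) - (dt / dx / 2) *\<^sub>R (f (equilibrate b) - f (equilibrate a))"
  have "((\<lambda>\<epsilon>. half_value \<epsilon> (dt / dx) dt a b) \<longlongrightarrow> equilibrate X) (at_right 0)"
    unfolding half_value_def X_def
    by (intro relax_tendsto implicit_weight_stiff_limit tendsto_intros f_tendsto
        relax_weight_stiff_limit dt equilibrate_in_K a b)
  moreover have "M1 *v X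
      = richtmyer_state (equilibrium_flux f M1 M2 Q) dt dx (M1 *v a) (M1 *v b)"
    by (simp add: X_def richtmyer_state_def equilibrium_flux_M1 matrix_vector_mult_diff_distrib
        matrix_vector_right_distrib matrix_vector_mult_scaleR add.commute mult.commute)
  ultimately show ?thesis
    by (simp add: equilibrate_def)
qed

text \<open>The admissibility of the predictor places the limit of the half-step states in \<open>K\<close>, where \<open>f\<close> is
known to be continuous.\<close>

lemma flux_value_stiff_limit:
  assumes dt: "0 < dt" and dx: "0 < dx" and a: "a \<in> K" and b: "b \<in> K"
  defines "\<phi> \<equiv> equilibrium_flux f M1 M2 Q"
  assumes adm: "richtmyer_state \<phi> dt dx (M1 *v a) (M1 *v b) \<in> (\<lambda>W. M1 *v W) ` K"
  shows "((\<lambda>\<epsilon>. M1 *v flux_value \<epsilon> (dt / dx) dt a b)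
      \<longlongrightarrow> force_flux \<phi> dt dx (M1 *v a) (M1 *v b)) (at_right 0)"
proof -
  let ?u = "richtmyer_state \<phi> dt dx (M1 *v a) (M1 *v b)"
  let ?e = "equilibrium M1 M2 Q ?u"
  have e: "?e \<in> K" "M1 *v ?e = ?u" "equilibrate ?e = ?e"
    using equilibrium_in_K[OF adm]
    by (simp_all add: equilibrate_def equilibrium_def state_of_components)
  have "((\<lambda>\<epsilon>. half_value \<epsilon> (dt / dx) dt a b) \<longlongrightarrow> ?e) (at_right 0)"
    unfolding \<phi>_def by (rule half_value_stiff_limit[OF dt a b])
  from relax_tendsto[OF relax_weight_stiff_limit[OF dt] this]
  have "((\<lambda>\<epsilon>. relax (relax_weight \<epsilon> dt) (half_value \<epsilon> (dt / dx) dt a b)) \<longlongrightarrow> ?e) (at_right 0)"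
    by (simp only: e(3))
  then have "((\<lambda>\<epsilon>. M1 *v flux_value \<epsilon> (dt / dx) dt a b) \<longlongrightarrow>
      M1 *v ((1 / 4) *\<^sub>R (2 *\<^sub>R f ?e + f (equilibrate a) + f (equilibrate b)
        - (1 / (dt / dx)) *\<^sub>R (b - a)))) (at_right 0)"
    unfolding flux_value_def
    by (intro M1_tendsto tendsto_intros f_tendsto relax_tendsto relax_weight_stiff_limit
        dt equilibrate_in_K a b e)
  also have "M1 *v ((1 / 4) *\<^sub>R (2 *\<^sub>R f ?e + f (equilibrate a) + f (equilibrate b)
        - (1 / (dt / dx)) *\<^sub>R (b - a))) = force_flux \<phi> dt dx (M1 *v a) (M1 *v b)"
    using equilibrium_flux_M1[of ?e] unfolding force_flux_eq[OF dt dx] e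
    by (simp add: \<phi>_def equilibrium_flux_M1 matrix_vector_mult_diff_distrib
        matrix_vector_right_distrib matrix_vector_mult_scaleR add.commute)
  finally show ?thesis .
qed

lemma M1_new:
  assumes step: "staggered_step K f R \<epsilon> dt dx r" and pos: "0 < \<epsilon>" "0 < dt" "0 < dx"
  shows "M1 *v new r j = M1 *v cells r j
    - (dt / dx) *\<^sub>R (M1 *v staggered_flux f dt dx r j - M1 *v staggered_flux f dt dx r (j - 1))"
proof -
  have "new r j \<in> K" "half r j \<in> K" "half r (j - 1) \<in> K"
    using step by (auto simp: staggered_step_def half_step_def)
  then have "M1 *v staggered_source R \<epsilon> r j = 0"
    by (simp add: staggered_source_def matrix_vector_right_distrib matrix_vector_mult_scaleR
        conserved)
  moreover have "new r j = cells r j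
      - (dt / dx) *\<^sub>R (staggered_flux f dt dx r j - staggered_flux f dt dx r (j - 1))
      + dt *\<^sub>R staggered_source R \<epsilon> r j"
    using conservative_form_holds[OF pos(1)] pos step unfolding conservative_form_def by blast
  ultimately show ?thesis
    by (simp add: matrix_vector_mult_diff_distrib matrix_vector_right_distrib
        matrix_vector_mult_scaleR)
qed

lemma equilibrium_flux_differentiable:
  assumes "V \<in> (\<lambda>W. M1 *v W) ` K"
  shows "equilibrium_flux f M1 M2 Q differentiable (at V)"
proof -
  have "(\<lambda>u. f (equilibrium M1 M2 Q u)) differentiable (at V)"
    by (rule differentiable_compose[where f = f, OF f_differentiable equilibrium_differentiable])
      (rule equilibrium_in_K[OF assms])
  then have "(\<lambda>u. M1 *v f (equilibrium M1 M2 Q u)) differentiable (at V)"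
    by (rule differentiable_compose[where f = "\<lambda>W. M1 *v W", rotated])
      (simp add: linear_imp_differentiable)
  then show ?thesis
    by (simp add: equilibrium_flux_def[abs_def])
qed

end

theorem proposition1:
  fixes K :: "(real^'n) set"
    and f R :: "real^'n \<Rightarrow> real^'n"
    and M1 :: "real^'n^'k"
    and M2 :: "real^'n^'m"
    and Q :: "real^'k \<Rightarrow> real^'m"
    and dt dx :: real
    and Wn :: "int \<Rightarrow> real^'n"
    and r :: "real \<Rightarrow> 'n run"
    and feq :: "real^'k \<Rightarrow> real^'k"
    and u uh :: "int \<Rightarrow> real^'k"
    and S :: "(real^'n) set"
  assumes system: "relaxation_system K f R M1 M2 Q"
    and mesh: "0 < dt" "0 < dx"
    and feq: "feq = equilibrium_flux f M1 M2 Q"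
    and u: "u = (\<lambda>j. M1 *v Wn j)"
    and uh: "uh = (\<lambda>j. richtmyer_state feq dt dx (u j) (u (j + 1)))"
    and scheme: "\<forall>\<epsilon>>0. cells (r \<epsilon>) = Wn \<and> staggered_step K f R \<epsilon> dt dx (r \<epsilon>)"
    and limit_states: "\<forall>j. uh j \<in> (\<lambda>W. M1 *v W) ` K"
    and S: "S = (\<Union>\<epsilon>\<in>{0<..}. run_states dt (r \<epsilon>))
                  \<union> range (\<lambda>j. equilibrium M1 M2 Q (u j)) \<union> range (\<lambda>j. equilibrium M1 M2 Q (uh j))"
    and cfl: "CFL f dt dx S"
  shows "(\<forall>\<epsilon>>0. finite_volume_consistent K f R \<epsilon>)
    \<and> (\<forall>j. ((\<lambda>\<epsilon>. M1 *v half (r \<epsilon>) j) \<longlongrightarrow> uh j) (at_right 0))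
    \<and> (\<forall>j. ((\<lambda>\<epsilon>. M1 *v staggered_flux f dt dx (r \<epsilon>) j)
              \<longlongrightarrow> force_flux feq dt dx (u j) (u (j + 1))) (at_right 0))
    \<and> (\<forall>j. ((\<lambda>\<epsilon>. M1 *v new (r \<epsilon>) j) \<longlongrightarrow> force_update feq dt dx u j) (at_right 0))
    \<and> (\<forall>j. force_flux feq dt dx (u j) (u (j + 1)) =
          (1 / 4) *\<^sub>R (2 *\<^sub>R feq (uh j) + feq (u (j + 1)) + feq (u j)
                        - (dx / dt) *\<^sub>R (u (j + 1) - u j)))
    \<and> consistent_two_point_flux ((\<lambda>W. M1 *v W) ` K) feq (force_flux feq dt dx)
    \<and> (\<forall>V\<in>(\<lambda>W. M1 *v W) ` K.
          real_diagonalizable (jacobian feq (at V)) \<and> subcharacteristic f S (jacobian feq (at V)) \<longrightarrow>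
          force_l2_stable (jacobian feq (at V)) dt dx)"
proof -
  interpret relaxation_system K f R M1 M2 Q
    by (rule system)
  have cells: "cells (r \<epsilon>) = Wn" and step: "staggered_step K f R \<epsilon> dt dx (r \<epsilon>)" if "0 < \<epsilon>" for \<epsilon>
    using scheme that by auto
  have Wn: "Wn j \<in> K" for j
    using step[of 1] cells[of 1] by (auto simp: staggered_step_def)
  have half: "((\<lambda>\<epsilon>. M1 *v half (r \<epsilon>) j) \<longlongrightarrow> uh j) (at_right 0)" for j
  proof (rule Lim_transform_eventually)
    show "((\<lambda>\<epsilon>. M1 *v half_value \<epsilon> (dt / dx) dt (Wn j) (Wn (j + 1))) \<longlongrightarrow> uh j) (at_right 0)"
      using M1_tendsto[OF half_value_stiff_limit[OF mesh(1) Wn Wn]]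
      by (simp add: uh u feq equilibrium_def state_of_components)
    show "\<forall>\<^sub>F \<epsilon> in at_right 0. M1 *v half_value \<epsilon> (dt / dx) dt (Wn j) (Wn (j + 1))
        = M1 *v half (r \<epsilon>) j"
      using eventually_at_right_less[of 0]
      by eventually_elim (simp add: staggered_step_values(1)[OF step _ mesh(1)] cells)
  qed
  have flux: "((\<lambda>\<epsilon>. M1 *v staggered_flux f dt dx (r \<epsilon>) j)
      \<longlongrightarrow> force_flux feq dt dx (u j) (u (j + 1))) (at_right 0)" for j
  proof (rule Lim_transform_eventually)
    show "((\<lambda>\<epsilon>. M1 *v flux_value \<epsilon> (dt / dx) dt (Wn j) (Wn (j + 1)))
        \<longlongrightarrow> force_flux feq dt dx (u j) (u (j + 1))) (at_right 0)"
      using flux_value_stiff_limit[OF mesh Wn Wn] limit_states by (simp add: uh u feq)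
    show "\<forall>\<^sub>F \<epsilon> in at_right 0. M1 *v flux_value \<epsilon> (dt / dx) dt (Wn j) (Wn (j + 1))
        = M1 *v staggered_flux f dt dx (r \<epsilon>) j"
      using eventually_at_right_less[of 0]
      by eventually_elim (simp add: staggered_step_values(3)[OF step _ mesh(1)] cells)
  qed
  have new: "((\<lambda>\<epsilon>. M1 *v new (r \<epsilon>) j) \<longlongrightarrow> force_update feq dt dx u j) (at_right 0)" for j
  proof (rule Lim_transform_eventually)
    have "((\<lambda>\<epsilon>. u j - (dt / dx) *\<^sub>R (M1 *v staggered_flux f dt dx (r \<epsilon>) j
          - M1 *v staggered_flux f dt dx (r \<epsilon>) (j - 1)))
        \<longlongrightarrow> u j - (dt / dx) *\<^sub>R (force_flux feq dt dx (u j) (u (j + 1))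
          - force_flux feq dt dx (u (j - 1)) (u (j - 1 + 1)))) (at_right 0)"
      by (intro tendsto_intros flux)
    then show "((\<lambda>\<epsilon>. u j - (dt / dx) *\<^sub>R (M1 *v staggered_flux f dt dx (r \<epsilon>) j
          - M1 *v staggered_flux f dt dx (r \<epsilon>) (j - 1))) \<longlongrightarrow> force_update feq dt dx u j) (at_right 0)"
      by (simp add: force_update_def)
    show "\<forall>\<^sub>F \<epsilon> in at_right 0. u j - (dt / dx) *\<^sub>R (M1 *v staggered_flux f dt dx (r \<epsilon>) j
          - M1 *v staggered_flux f dt dx (r \<epsilon>) (j - 1)) = M1 *v new (r \<epsilon>) j"
      using eventually_at_right_less[of 0]
      by eventually_elim (simp add: M1_new[OF step _ mesh] cells u)
  qed
  have stable: "force_l2_stable (jacobian feq (at V)) dt dx"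
    if diag: "real_diagonalizable (jacobian feq (at V))"
      and sub: "subcharacteristic f S (jacobian feq (at V))" for V
  proof (rule force_l2_stable_if_cfl[OF diag mesh])
    fix \<mu>
    assume "eigenvalue (jacobian feq (at V)) \<mu>"
    then obtain W l where "W \<in> S" "eigenvalue (jacobian f (at W)) l" "\<bar>\<mu>\<bar> \<le> \<bar>l\<bar>"
      using sub unfolding subcharacteristic_def by blast
    moreover from this have "dt * \<bar>l\<bar> \<le> dx"
      using cfl unfolding CFL_def by blast
    ultimately show "dt * \<bar>\<mu>\<bar> \<le> dx"
      using mesh(1) by (meson mult_left_mono less_imp_le order_trans)
  qed
  have flux_formula: "force_flux feq dt dx (u j) (u (j + 1)) =
      (1 / 4) *\<^sub>R (2 *\<^sub>R feq (uh j) + feq (u (j + 1)) + feq (u j)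
        - (dx / dt) *\<^sub>R (u (j + 1) - u j))" for j
    unfolding force_flux_eq[OF mesh] uh by (rule refl)
  moreover have "consistent_two_point_flux ((\<lambda>W. M1 *v W) ` K) feq (force_flux feq dt dx)"
    unfolding feq by (rule consistent_force_flux[OF equilibrium_flux_differentiable])
  ultimately show ?thesis
    using finite_volume_consistent_holds half flux new stable flux_formula by blast
qed

end
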